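(* Let $T>0$ and let $F$, $A$, $X_0$ satisfy the standing assumptions (i)-(iii) of the context, with Lipschitz constant $L$. For every integer $N\ge 1$ let $h_N:=T/N$, and let the blowup size be $\beta_N:=L(P+1)h_N^2$, where $P$ is the constant of the context (the relaxation parameter is $\delta_N=0$). Then: (a) For every $\tau\in(0,\tau^*]$, $$\sup_{y_N\in S^c_N(\lfloor\tau/h_N\rfloor,\beta_N,0)}\ \inf_{x(\cdot)\in S^c(\tau)}\ \max_{n=0,\ldots,\lfloor\tau/h_N\rfloor}\|y_{N,n}-x(t_{N,n})\|\to 0\quad\text{as } N\to\infty.$$ (b) For every $\tau\in(\tau^*,T]$ there exists $N_\tau\in\mathbb{N}$ such that $S^c_N(\lfloor\tau/h_N\rfloor,\beta_N,0)=\emptyset$ for all $N\ge N_\tau$.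
   Context: Notation: $\|\cdot\|$ is the Euclidean norm on $\mathbb{R}^d$; for a point $a$ and a set $B$, $\mathrm{dist}(a,B)=\inf_{b\in B}\|a-b\|$ (with $\mathrm{dist}(a,\emptyset)=+\infty$); for sets $A,B$, $\mathrm{dist}(A,B)=\sup_{a\in A}\mathrm{dist}(a,B)$; $B_\rho(0)$ is the closed ball of radius $\rho$; $\|F(0,x)\|:=\sup_{v\in F(0,x)}\|v\|$. $W^{1,1}([0,\tau],\mathbb{R}^d)$ is the space of absolutely continuous functions. Standing assumptions: (i) $F:[0,T]\times\mathbb{R}^d\rightrightarrows\mathbb{R}^d$ has nonempty, convex, compact values and there is $L>0$ with $\mathrm{dist}(F(t,x),F(t',x'))\le L|t-t'|+L\|x-x'\|$ for all $t,t'\in[0,T]$, $x,x'\in\mathbb{R}^d$. (ii) $A:[0,T]\rightrightarrows\mathbb{R}^d$ has closed values, and $t_n\to t$, $x_n\in A(t_n)$, $x_n\to x$ imply $x\in A(t)$. (iii) $X_0\subset\mathbb{R}^d$ is compact, and there is $\tau\in(0,T]$ with $S^c(\tau)\ne\emptyset$. Exact solutions: for $\tau\in(0,T]$, $S^u(\tau)$ is the set of $x(\cdot)\in W^{1,1}([0,\tau],\mathbb{R}^d)$ with $\dot x(t)\in F(t,x(t))$ for a.e. $t\in(0,\tau)$ and $x(0)\in X_0$; $S^c(\tau)$ is the set of $x(\cdot)\in S^u(\tau)$ with $x(t)\in A(t)$ for all $t\in[0,\tau]$. Put $\tau^*:=\sup\{\tau\in(0,T]:S^c(\tau)\neq\emptyset\}$.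 Inflated Euler scheme: $h_N=T/N$, $t_{N,n}=nh_N$. For $\beta,\delta\ge0$ and $\nu\in\{0,\ldots,N\}$, $S^c_N(\nu,\beta,\delta)$ is the set of finite sequences $y_N=(y_{N,n})_{n=0}^\nu\subset\mathbb{R}^d$ with $y_{N,n+1}\in y_{N,n}+h_NF(t_{N,n},y_{N,n})+B_{\beta}(0)$ for $0\le n\le\nu-1$, $\mathrm{dist}(y_{N,0},X_0)\le\delta$, and $\mathrm{dist}(y_{N,n},A(t_{N,n}))\le\delta$ for $0\le n\le\nu$. The constants: with blowup sizes $\beta_N\ge0$, $\beta_N/h_N\to0$, and relaxation parameters $\delta_N=0$, $$R:=\max\{1,\tfrac1L\}\,e^{LT}\Big(\sup_{x\in X_0}\|F(0,x)\|+\sup_{N\ge1}\big(\delta_N+\tfrac{\beta_N}{Lh_N}\big)+1\Big)<\infty,\qquad P:=L(T+R)+\sup_{x\in X_0}\|F(0,x)\|.$$ The relations defining $\beta_N$, $R$ and $P$ are understood to hold simultaneously. *)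

theory Defs
  imports "HOL-Analysis.Analysis"
begin

(* Distances take values in ereal, so that the distance to the empty set is +infinity;
   the library's infdist and setdist are 0 there. *)

definition point_dist :: "'a::real_normed_vector \<Rightarrow> 'a set \<Rightarrow> ereal" where
  "point_dist a B = (INF b\<in>B. ereal (norm (a - b)))"

definition excess :: "'a::real_normed_vector set \<Rightarrow> 'a set \<Rightarrow> ereal" where
  "excess A B = (SUP a\<in>A. point_dist a B)"

definition abs_continuous_on :: "real \<Rightarrow> real \<Rightarrow> (real \<Rightarrow> 'a::real_normed_vector) \<Rightarrow> bool" where
  "abs_continuous_on a b f \<longleftrightarrow>
     (\<forall>\<epsilon>>0. \<exists>\<delta>>0. \<forall>(m::nat) (u::nat \<Rightarrow> real) (v::nat \<Rightarrow> real).
        (\<forall>i<m. a \<le> u i \<and> u i \<le> v i \<and> v i \<le> b) \<longrightarrow>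
        (\<forall>i<m. \<forall>j<m. i \<noteq> j \<longrightarrow> {u i<..<v i} \<inter> {u j<..<v j} = {}) \<longrightarrow>
        (\<Sum>i<m. v i - u i) < \<delta> \<longrightarrow>
        (\<Sum>i<m. norm (f (v i) - f (u i))) < \<epsilon>)"

(* Trajectories on [0,tau] are functions on the reals whose values outside [0,tau] are
   unconstrained. *)

definition unconstrained_sols ::
    "(real \<Rightarrow> 'a::euclidean_space \<Rightarrow> 'a set) \<Rightarrow> 'a set \<Rightarrow> real \<Rightarrow> (real \<Rightarrow> 'a) set" where
  "unconstrained_sols F X0 \<tau> =
     {x. abs_continuous_on 0 \<tau> x \<and>
         (AE t in lebesgue. t \<in> {0<..<\<tau>} \<longrightarrow>
            (\<exists>v\<in>F t (x t). (x has_vector_derivative v) (at t))) \<and>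
         x 0 \<in> X0}"

definition constrained_sols ::
    "(real \<Rightarrow> 'a::euclidean_space \<Rightarrow> 'a set) \<Rightarrow> (real \<Rightarrow> 'a set) \<Rightarrow> 'a set \<Rightarrow> real \<Rightarrow> (real \<Rightarrow> 'a) set" where
  "constrained_sols F A X0 \<tau> = {x \<in> unconstrained_sols F X0 \<tau>. \<forall>t\<in>{0..\<tau>}. x t \<in> A t}"

definition max_time ::
    "real \<Rightarrow> (real \<Rightarrow> 'a::euclidean_space \<Rightarrow> 'a set) \<Rightarrow> (real \<Rightarrow> 'a set) \<Rightarrow> 'a set \<Rightarrow> real" where
  "max_time T F A X0 = Sup {\<tau> \<in> {0<..T}. constrained_sols F A X0 \<tau> \<noteq> {}}"

definition step_size :: "real \<Rightarrow> nat \<Rightarrow> real" where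
  "step_size T N = T / real N"

definition grid_pt :: "real \<Rightarrow> nat \<Rightarrow> nat \<Rightarrow> real" where
  "grid_pt T N n = real n * step_size T N"

definition grid_index :: "real \<Rightarrow> nat \<Rightarrow> real \<Rightarrow> nat" where
  "grid_index T N \<tau> = nat \<lfloor>\<tau> / step_size T N\<rfloor>"

(* A finite sequence (y_0, ..., y_nu) is a function on the naturals whose values beyond nu are
   unconstrained. *)

definition inflated_euler ::
    "real \<Rightarrow> (real \<Rightarrow> 'a::euclidean_space \<Rightarrow> 'a set) \<Rightarrow> (real \<Rightarrow> 'a set) \<Rightarrow> 'a set \<Rightarrow>
     nat \<Rightarrow> nat \<Rightarrow> real \<Rightarrow> real \<Rightarrow> (nat \<Rightarrow> 'a) set" where
  "inflated_euler T F A X0 N \<nu> \<beta> \<delta> =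
     {y. (\<forall>n<\<nu>. \<exists>v\<in>F (grid_pt T N n) (y n). \<exists>b\<in>cball 0 \<beta>.
            y (Suc n) = y n + step_size T N *\<^sub>R v + b) \<and>
         point_dist (y 0) X0 \<le> ereal \<delta> \<and>
         (\<forall>n\<le>\<nu>. point_dist (y n) (A (grid_pt T N n)) \<le> ereal \<delta>)}"

(* The suprema below are suprema of reals: init_speed is applied to a nonempty compact X0 and a
   Lipschitz F with nonempty compact values, radius_const to sequences with delta N + beta N / h
   bounded. *)

definition init_speed :: "(real \<Rightarrow> 'a::euclidean_space \<Rightarrow> 'a set) \<Rightarrow> 'a set \<Rightarrow> real" where
  "init_speed F X0 = (SUP x\<in>X0. SUP v\<in>F 0 x. norm v)"

definition radius_const ::
    "real \<Rightarrow> real \<Rightarrow> (real \<Rightarrow> 'a::euclidean_space \<Rightarrow> 'a set) \<Rightarrow> 'a set \<Rightarrow>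
     (nat \<Rightarrow> real) \<Rightarrow> (nat \<Rightarrow> real) \<Rightarrow> real" where
  "radius_const T L F X0 \<beta> \<delta> =
     max 1 (1 / L) * exp (L * T) *
       (init_speed F X0 + (SUP N\<in>{1..}. \<delta> N + \<beta> N / (L * step_size T N)) + 1)"

definition speed_const ::
    "real \<Rightarrow> real \<Rightarrow> (real \<Rightarrow> 'a::euclidean_space \<Rightarrow> 'a set) \<Rightarrow> 'a set \<Rightarrow> real \<Rightarrow> real" where
  "speed_const T L F X0 R = L * (T + R) + init_speed F X0"

end

(* Compactness argument. The definition of R forces R > (P + 1) T, and the speed is at most P as
   long as a trajectory or Euler sequence stays in the ball of radius R around its initial point;
   hence neither leaves that ball, and no Gronwall estimate is needed.

   Let y_k be inflated Euler sequences with step sizes tending to 0 and end times tending to tau.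
   Their piecewise linear interpolants are equi-Lipschitz, so by Arzela-Ascoli a subsequence
   converges uniformly to a Lipschitz function x. It is differentiable almost everywhere, and its
   difference quotients are limits of averages of elements of thickenings of the convex compact set
   F(t, x(t)); so x'(t) lies in F(t, x(t)). The closed graph of A gives the state constraint.

   Conversely, the mean value theorem for absolutely continuous functions and convex sets shows
   that the restriction of an exact solution to the grid is an inflated Euler sequence for the given
   beta_N. Applied to solutions on intervals [0, tau_k] with tau_k tending to tau*, this yields a
   constrained solution on [0, tau*]. Both (a) and (b) then follow by contradiction, choosing Euler
   sequences that violate the claim for infinitely many N. *)

theory Submission
  imports Defs "HOL-Complex_Analysis.Great_Picard"
begin

text \<open>\<open>P\<close> and \<open>R\<close> are coupled: \<open>P\<close> contains
  \<open>R\<close>, and \<open>R\<close> contains the supremum over N of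
  \<open>\<beta> N / (L * h) = (P + 1) * h\<close> with \<open>h = T / N\<close>. It is attained at
  N = 1 with value \<open>(P + 1) * T\<close>; the prefactor of \<open>R\<close> is at least 1 and
  the summand 1 makes the inequality strict. The analytic obstacle is that velocities are known only
  almost everywhere. Passing from velocities to increments needs absolute continuity, since the
  Cantor function increases with derivative zero almost everywhere. Passing from increments to
  velocities needs almost everywhere differentiability of the limit, which is why the limit must be
  Lipschitz. Convexity links both directions: an average of velocities stays in a convex set, by
  separation for exact solutions and as a finite convex combination for Euler sequences. The form of
  \<open>\<beta> N\<close> is what sampling produces: along one step F varies by at most
  \<open>L * (P + 1) * h\<close>, and one more factor \<open>h\<close> comes from the length of the
  step. As sampled solutions are Euler sequences, one compactness result with varying end times
  serves exact solutions as well.\<close>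

section \<open>Differentiability of Lipschitz functions of one variable\<close>

text \<open>The Lebesgue measure of \<open>g ` S\<close> is absolutely continuous in \<open>S\<close> because Lipschitz images of
  null sets are null; \<open>d\<close> is its Radon-Nikodym density.\<close>
lemma bilipschitz_density:
  fixes g :: "real \<Rightarrow> real"
  assumes lower: "\<And>s t. s \<le> t \<Longrightarrow> t - s \<le> g t - g s"
    and upper: "\<And>s t. s \<le> t \<Longrightarrow> g t - g s \<le> C * (t - s)"
  obtains d where "\<And>a b. a \<le> b \<Longrightarrow> (d has_integral (g b - g a)) {a..b}"
proof -
  have lip: "\<bar>g t - g s\<bar> \<le> C * \<bar>t - s\<bar>" for s t
    using lower[of s t] upper[of s t] lower[of t s] upper[of t s] by (cases "s \<le> t") auto
  have low: "\<bar>t - s\<bar> \<le> \<bar>g t - g s\<bar>" for s t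
    using lower[of s t] lower[of t s] by (cases "s \<le> t") auto
  have "C \<ge> 0" using lip[of 1 0] by simp
  have mono: "s \<le> t \<longleftrightarrow> g s \<le> g t" for s t
    using lower[of s t] lower[of t s] by (cases "s \<le> t") auto
  have inj: "inj g" using low by (metis abs_eq_0 abs_ge_zero diff_self dual_order.antisym eq_iff_diff_eq_0 injI)
  have "C-lipschitz_on UNIV g"
    using lip \<open>C \<ge> 0\<close> by (intro lipschitz_onI) (auto simp: dist_real_def)
  then have cont: "continuous_on S g" for S
    using lipschitz_on_continuous_on continuous_on_subset by blast
  have surj: "\<exists>x. g x = y" for y
  proof -
    \<comment> \<open>The lower bound makes \<open>g\<close> expanding, so
      \<open>g r >= g 0 + r >= y\<close>, and likewise \<open>g (-r) <= y\<close>: the value y is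
      bracketed.\<close>
    define r where "r = \<bar>y - g 0\<bar>"
    have "g (-r) \<le> y" "y \<le> g r" "-r \<le> r"
      using lower[of "-r" 0] lower[of 0 r] unfolding r_def by auto
    then show ?thesis using IVT'[of g "-r" y r] cont by blast
  qed
  define \<phi> where "\<phi> = inv g"
  have g\<phi>: "g (\<phi> y) = y" for y using surj by (simp add: \<phi>_def f_inv_into_f surj_def image_iff) (metis f_inv_into_f rangeI)
  have \<phi>g: "\<phi> (g x) = x" for x by (simp add: \<phi>_def inj)
  have "1-lipschitz_on UNIV \<phi>"
    using low[of "\<phi> _" "\<phi> _"] by (intro lipschitz_onI) (auto simp: dist_real_def g\<phi>)
  then have [measurable]: "\<phi> \<in> borel_measurable borel"
    using lipschitz_on_continuous_on borel_measurable_continuous_onI by blast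
  \<comment> \<open>The preimage of S under the inverse is the image of S under \<open>g\<close>. As
    a push-forward of Lebesgue measure, \<open>\<mu>\<close> is a measure without any check of
    additivity.\<close>
  define \<mu> where "\<mu> = distr lborel borel \<phi>"
  have vim: "\<phi> -` S = g ` S" for S using g\<phi> \<phi>g by (auto simp: image_iff) (metis g\<phi>)
  have em: "emeasure \<mu> S = emeasure lborel (g ` S)" if "S \<in> sets borel" for S
    using that by (simp add: \<mu>_def emeasure_distr vim)
  have "g ` {a..b} = {g a..g b}" for a b
    using mono g\<phi> \<phi>g by (auto simp: image_iff) (metis atLeastAtMost_iff g\<phi> mono)
  then have emI: "emeasure \<mu> {a..b} = ennreal (g b - g a)" if "a \<le> b" for a b
    using em[of "{a..b}"] that mono by simp
  have "absolutely_continuous lborel \<mu>"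
    unfolding absolutely_continuous_def
  proof
    fix S :: "real set" assume S: "S \<in> null_sets lborel"
    then have "negligible S" "S \<in> sets borel"
      using null_sets_completionI[OF S] by (simp_all add: negligible_iff_null_sets null_sets_def)
    have "negligible (g ` S)"
    proof (rule negligible_locally_Lipschitz_image[OF _ \<open>negligible S\<close>])
      show "\<exists>T B. open T \<and> x \<in> T \<and> (\<forall>y\<in>S \<inter> T. norm (g y - g x) \<le> B * norm (y - x))" for x
        using lip by (intro exI[of _ UNIV] exI[of _ C]) auto
    qed simp
    moreover have "g ` S \<in> sets borel"
      using measurable_sets[of \<phi> borel borel S] \<open>S \<in> sets borel\<close> by (simp add: vim)
    ultimately have "emeasure lborel (g ` S) = 0"
      by (auto simp: negligible_iff_null_sets null_sets_def)
    then show "S \<in> null_sets \<mu>" using em \<open>S \<in> sets borel\<close> by (auto simp: null_sets_def \<mu>_def)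
  qed
  then obtain d0 where d0[measurable]: "d0 \<in> borel_measurable lborel" and dens: "density lborel d0 = \<mu>"
    using sigma_finite_measure.Radon_Nikodym[OF sigma_finite_lborel, of \<mu>] by (auto simp: \<mu>_def)
  \<comment> \<open>The density may be infinite, but its integral over every bounded interval is
    finite, so \<open>enn2real\<close> alters it only on a null set.\<close>
  define d where "d x = enn2real (d0 x)" for x
  have "(d has_integral (g b - g a)) {a..b}" if "a \<le> b" for a b
  proof -
    have i: "(\<integral>\<^sup>+x. d0 x * indicator {a..b} x \<partial>lborel) = ennreal (g b - g a)"
      using emI[OF that] by (simp add: dens[symmetric] emeasure_density)
    then have "AE x in lborel. d0 x * indicator {a..b} x \<noteq> \<infinity>"
      by (intro nn_integral_PInf_AE) auto
    then have "(\<integral>\<^sup>+x. ennreal (d x * indicator {a..b} x) \<partial>lborel)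
        = (\<integral>\<^sup>+x. d0 x * indicator {a..b} x \<partial>lborel)"
      by (intro nn_integral_cong_AE)
        (auto elim!: eventually_mono simp: d_def indicator_def less_top[symmetric] split: if_splits)
    then have "((\<lambda>x. d x * indicator {a..b} x) has_integral (g b - g a)) UNIV"
      using i lower[OF that] that
      by (intro nn_integral_has_integral) (auto simp: d_def)
    moreover have "(\<lambda>x. d x * indicator {a..b} x) = (\<lambda>x. if x \<in> {a..b} then d x else 0)"
      by (auto simp: indicator_def)
    ultimately show ?thesis using has_integral_restrict_UNIV by metis
  qed
  then show ?thesis using that by blast
qed

text \<open>Lebesgue differentiation over cubes that have x as their lower corner; in dimension one
  these are the intervals to the right of x, so only right quotients are obtained.\<close>

lemma indefinite_integral_right_quotient:
  fixes g :: "real \<Rightarrow> real"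
  assumes d: "\<And>a b. a \<le> b \<Longrightarrow> (d has_integral (g b - g a)) {a..b}"
  obtains N where "negligible N"
    "\<And>x e. x \<notin> N \<Longrightarrow> 0 < e \<Longrightarrow> \<exists>\<delta>>0. \<forall>h. 0 < h \<and> h < \<delta> \<longrightarrow> \<bar>(g (x + h) - g x) / h - d x\<bar> < e"
proof -
  have "d integrable_on cbox a b" for a b
    using d[of a b] by (cases "a \<le> b") auto
  then obtain N where N: "negligible N"
    "\<And>x e. x \<notin> N \<Longrightarrow> 0 < e \<Longrightarrow> \<exists>\<delta>>0. \<forall>h. 0 < h \<and> h < \<delta> \<longrightarrow>
       norm (integral (cbox x (x + h *\<^sub>R One)) d /\<^sub>R h ^ DIM(real) - d x) < e"
    using integrable_ccontinuous_explicit[of d] by blast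
  show ?thesis
  proof (rule that[OF N(1)])
    fix x e :: real assume "x \<notin> N" "0 < e"
    then obtain \<delta> where "\<delta> > 0" and \<delta>: "\<And>h. 0 < h \<and> h < \<delta> \<Longrightarrow>
       norm (integral (cbox x (x + h *\<^sub>R One)) d /\<^sub>R h ^ DIM(real) - d x) < e"
      using N(2) by metis
    have "\<bar>(g (x + h) - g x) / h - d x\<bar> < e" if "0 < h \<and> h < \<delta>" for h
      using \<delta>[OF that] integral_unique[OF d[of x "x + h"]] that by (simp add: divide_inverse mult.commute)
    then show "\<exists>\<delta>>0. \<forall>h. 0 < h \<and> h < \<delta> \<longrightarrow> \<bar>(g (x + h) - g x) / h - d x\<bar> < e"
      using \<open>\<delta> > 0\<close> by blast
  qed
qed

text \<open>The missing left quotients are right quotients of the reflected function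
  \<open>k\<close>, whose exceptional set is reflected back and remains null.\<close>

lemma indefinite_integral_differentiable_ae:
  fixes g :: "real \<Rightarrow> real"
  assumes d: "\<And>a b. a \<le> b \<Longrightarrow> (d has_integral (g b - g a)) {a..b}"
  obtains N where "negligible N" "\<And>x. x \<notin> N \<Longrightarrow> (g has_real_derivative d x) (at x)"
proof -
  obtain N1 where N1: "negligible N1"
    "\<And>x e. x \<notin> N1 \<Longrightarrow> 0 < e \<Longrightarrow> \<exists>\<delta>>0. \<forall>h. 0 < h \<and> h < \<delta> \<longrightarrow> \<bar>(g (x + h) - g x) / h - d x\<bar> < e"
    using indefinite_integral_right_quotient[OF d] by blast
  define k where "k x = - g (- x)" for x
  have "((\<lambda>x. d (- x)) has_integral (k b - k a)) {a..b}" if "a \<le> b" for a b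
    using has_integral_reflect_real[of d "g (-a) - g (-b)" "-a" "-b"] d[of "-b" "-a"] that
    by (simp add: k_def)
  then obtain N2 where N2: "negligible N2"
    "\<And>x e. x \<notin> N2 \<Longrightarrow> 0 < e \<Longrightarrow> \<exists>\<delta>>0. \<forall>h. 0 < h \<and> h < \<delta> \<longrightarrow> \<bar>(k (x + h) - k x) / h - d (- x)\<bar> < e"
    using indefinite_integral_right_quotient[of "\<lambda>x. d (- x)" k] by blast
  have neg: "negligible (uminus ` N2)"
  proof (rule negligible_locally_Lipschitz_image[OF _ N2(1)])
    show "\<exists>T B. open T \<and> x \<in> T \<and> (\<forall>y\<in>N2 \<inter> T. norm (- y - - x) \<le> B * norm (y - x))" for x
      by (intro exI[of _ UNIV] exI[of _ 1]) auto
  qed simp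
  show ?thesis
  proof (rule that[of "N1 \<union> uminus ` N2"])
    show "negligible (N1 \<union> uminus ` N2)" using N1(1) neg by simp
    fix x assume x: "x \<notin> N1 \<union> uminus ` N2"
    then have "- x \<notin> N2" by (metis UnCI add.inverse_inverse imageI)
    show "(g has_real_derivative d x) (at x)"
      unfolding DERIV_def LIM_eq
    proof (intro allI impI)
      fix e :: real assume "0 < e"
      obtain d1 where "d1 > 0" and d1: "\<And>h. 0 < h \<and> h < d1 \<Longrightarrow> \<bar>(g (x + h) - g x) / h - d x\<bar> < e"
        using N1(2)[of x e] x \<open>0 < e\<close> by blast
      obtain d2 where "d2 > 0" and d2: "\<And>h. 0 < h \<and> h < d2 \<Longrightarrow> \<bar>(k (- x + h) - k (- x)) / h - d x\<bar> < e"
        using N2(2)[of "- x" e] \<open>- x \<notin> N2\<close> \<open>0 < e\<close> by fastforce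
      have "\<bar>(g (x + h) - g x) / h - d x\<bar> < e" if "h \<noteq> 0" "\<bar>h\<bar> < min d1 d2" for h
      proof (cases "h > 0")
        case True then show ?thesis using d1[of h] that by simp
      next
        case False
        have "(k (- x + - h) - k (- x)) / - h = (g (x + h) - g x) / h"
          using that(1) by (simp add: k_def field_simps)
        then show ?thesis using d2[of "- h"] that False by simp
      qed
      then show "\<exists>s>0. \<forall>xa. xa \<noteq> 0 \<and> norm (xa - 0) < s \<longrightarrow> norm ((g (x + xa) - g x) / xa - d x) < e"
        using \<open>d1 > 0\<close> \<open>d2 > 0\<close> by (intro exI[of _ "min d1 d2"]) auto
    qed
  qed
qed

lemma lipschitz_real_differentiable_ae:
  fixes f :: "real \<Rightarrow> real"
  assumes "M-lipschitz_on UNIV f"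
  obtains N where "negligible N" "\<And>x. x \<notin> N \<Longrightarrow> \<exists>D. (f has_real_derivative D) (at x)"
proof -
  \<comment> \<open>The slopes of f lie between \<open>-M\<close> and \<open>M\<close>; the linear
    term moves them to between 1 and \<open>2 * M + 1\<close>, the form that
    \<open>bilipschitz_density\<close> requires.\<close>
  define g where "g t = f t + (M + 1) * t" for t
  have f: "\<bar>f t - f s\<bar> \<le> M * (t - s)" if "s \<le> t" for s t
    using lipschitz_onD[OF assms, of t s] that by (simp add: dist_real_def)
  have "t - s \<le> g t - g s" "g t - g s \<le> (2 * M + 1) * (t - s)" if "s \<le> t" for s t
    using f[OF that] by (auto simp: g_def algebra_simps)
  then obtain d where "\<And>a b. a \<le> b \<Longrightarrow> (d has_integral (g b - g a)) {a..b}"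
    using bilipschitz_density[of g "2 * M + 1"] by blast
  then obtain N where N: "negligible N" "\<And>x. x \<notin> N \<Longrightarrow> (g has_real_derivative d x) (at x)"
    using indefinite_integral_differentiable_ae by blast
  have "(f has_real_derivative d x - (M + 1)) (at x)" if "x \<notin> N" for x
  proof -
    have "((\<lambda>t. g t - (M + 1) * t) has_real_derivative d x - (M + 1)) (at x)"
      by (rule derivative_eq_intros N(2)[OF that] refl | simp)+
    then show ?thesis by (simp add: g_def)
  qed
  then show ?thesis using that N(1) by blast
qed

lemma lipschitz_differentiable_ae:
  fixes x :: "real \<Rightarrow> 'a::euclidean_space"
  assumes "M-lipschitz_on UNIV x"
  shows "AE t in lebesgue. \<exists>v. (x has_vector_derivative v) (at t)"
proof -
  have "\<exists>N. negligible N \<and> (\<forall>t. t \<notin> N \<longrightarrow> (\<exists>D. ((\<lambda>t. x t \<bullet> i) has_real_derivative D) (at t)))"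
    if "i \<in> Basis" for i
  proof -
    have "M-lipschitz_on UNIV (\<lambda>t. x t \<bullet> i)"
    proof (rule lipschitz_onI)
      fix s t
      have "\<bar>(x s - x t) \<bullet> i\<bar> \<le> norm (x s - x t)" using Basis_le_norm[OF that] .
      then show "dist (x s \<bullet> i) (x t \<bullet> i) \<le> M * dist s t"
        using lipschitz_onD[OF assms, of s t] by (simp add: dist_norm inner_diff_left)
    qed (use lipschitz_on_nonneg[OF assms] in simp)
    then show ?thesis using lipschitz_real_differentiable_ae by metis
  qed
  then obtain N D where N: "\<And>i. i \<in> Basis \<Longrightarrow> negligible (N i)"
    and D: "\<And>i t. i \<in> Basis \<Longrightarrow> t \<notin> N i \<Longrightarrow> ((\<lambda>t. x t \<bullet> i) has_real_derivative D i t) (at t)"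
    by metis
  have "negligible (\<Union>i\<in>Basis. N i)" using N by (intro negligible_Union) auto
  moreover have "(x has_vector_derivative (\<Sum>i\<in>Basis. D i t *\<^sub>R i)) (at t)" if "t \<notin> (\<Union>i\<in>Basis. N i)" for t
  proof -
    have "((\<lambda>t. \<Sum>i\<in>Basis. (x t \<bullet> i) *\<^sub>R i) has_vector_derivative (\<Sum>i\<in>Basis. D i t *\<^sub>R i)) (at t)"
      using D that
      by (intro has_vector_derivative_sum) (auto intro!: derivative_eq_intros)
    then show ?thesis by (simp add: euclidean_representation)
  qed
  ultimately show ?thesis
    by (intro AE_I'[of "\<Union>i\<in>Basis. N i"]) (auto simp: negligible_iff_null_sets)
qed

section \<open>Absolutely continuous functions\<close>

lemma abs_continuous_onE:
  assumes "abs_continuous_on a b f" "\<epsilon> > 0"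
  obtains \<delta> where "\<delta> > 0"
    "\<forall>(m::nat) u v. (\<forall>i<m. a \<le> u i \<and> u i \<le> v i \<and> v i \<le> b) \<longrightarrow>
        (\<forall>i<m. \<forall>j<m. i \<noteq> j \<longrightarrow> {u i<..<v i} \<inter> {u j<..<v j} = {}) \<longrightarrow>
        (\<Sum>i<m. v i - u i) < \<delta> \<longrightarrow> (\<Sum>i<m. norm (f (v i) - f (u i))) < \<epsilon>"
proof -
  obtain \<delta> where \<delta>: "\<delta> > 0"
    "\<forall>(m::nat) u v. (\<forall>i<m. a \<le> u i \<and> u i \<le> v i \<and> v i \<le> b) \<longrightarrow>
        (\<forall>i<m. \<forall>j<m. i \<noteq> j \<longrightarrow> {u i<..<v i} \<inter> {u j<..<v j} = {}) \<longrightarrow>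
        (\<Sum>i<m. v i - u i) < \<delta> \<longrightarrow> (\<Sum>i<m. norm (f (v i) - f (u i))) < \<epsilon>"
    using assms(1)[unfolded abs_continuous_on_def, rule_format, OF assms(2)] by (elim exE conjE)
  show ?thesis by (rule that[OF \<delta>])
qed

lemma abs_continuous_onI:
  assumes "\<And>\<epsilon>. \<epsilon> > 0 \<Longrightarrow> \<exists>\<delta>>0. \<forall>(m::nat) u v. (\<forall>i<m. a \<le> u i \<and> u i \<le> v i \<and> v i \<le> b) \<longrightarrow>
        (\<forall>i<m. \<forall>j<m. i \<noteq> j \<longrightarrow> {u i<..<v i} \<inter> {u j<..<v j} = {}) \<longrightarrow>
        (\<Sum>i<m. v i - u i) < \<delta> \<longrightarrow> (\<Sum>i<m. norm (f (v i) - f (u i))) < \<epsilon>"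
  shows "abs_continuous_on a b f"
  using assms unfolding abs_continuous_on_def by simp

lemma abs_continuous_on_subinterval:
  assumes "abs_continuous_on a b x" "a \<le> a'" "b' \<le> b"
  shows "abs_continuous_on a' b' x"
proof (rule abs_continuous_onI)
  fix \<epsilon> :: real assume "\<epsilon> > 0"
  obtain \<delta> where "\<delta> > 0" and \<delta>: "\<forall>(m::nat) u v. (\<forall>i<m. a \<le> u i \<and> u i \<le> v i \<and> v i \<le> b) \<longrightarrow>
        (\<forall>i<m. \<forall>j<m. i \<noteq> j \<longrightarrow> {u i<..<v i} \<inter> {u j<..<v j} = {}) \<longrightarrow>
        (\<Sum>i<m. v i - u i) < \<delta> \<longrightarrow> (\<Sum>i<m. norm (x (v i) - x (u i))) < \<epsilon>"
    by (rule abs_continuous_onE[OF assms(1) \<open>\<epsilon> > 0\<close>])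
  have "(\<Sum>i<m. norm (x (v i) - x (u i))) < \<epsilon>"
    if "\<forall>i<m. a' \<le> u i \<and> u i \<le> v i \<and> v i \<le> b'"
      "\<forall>i<m. \<forall>j<m. i \<noteq> j \<longrightarrow> {u i<..<v i} \<inter> {u j<..<v j} = {}"
      "(\<Sum>i<m. v i - u i) < \<delta>" for m :: nat and u v
    using that assms(2,3) by (intro \<delta>[rule_format]) force+
  then show "\<exists>\<delta>>0. \<forall>(m::nat) u v. (\<forall>i<m. a' \<le> u i \<and> u i \<le> v i \<and> v i \<le> b') \<longrightarrow>
        (\<forall>i<m. \<forall>j<m. i \<noteq> j \<longrightarrow> {u i<..<v i} \<inter> {u j<..<v j} = {}) \<longrightarrow>
        (\<Sum>i<m. v i - u i) < \<delta> \<longrightarrow> (\<Sum>i<m. norm (x (v i) - x (u i))) < \<epsilon>"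
    using \<open>\<delta> > 0\<close> by blast
qed

text \<open>A common source for two later facts: Lipschitz functions are absolutely continuous (take
  x constant), and so is a linear functional of an absolutely continuous curve plus a linear
  function of time.\<close>

lemma abs_continuous_on_dominated:
  assumes ac: "abs_continuous_on a b x"
    and le: "\<And>u v. a \<le> u \<Longrightarrow> u \<le> v \<Longrightarrow> v \<le> b \<Longrightarrow>
      norm (y v - y u) \<le> C * ((v - u) + norm (x v - x u))"
    and "C > 0"
  shows "abs_continuous_on a b y"
proof (rule abs_continuous_onI)
  fix \<epsilon> :: real assume "\<epsilon> > 0"
  then have \<epsilon>': "\<epsilon> / (2 * C) > 0" using \<open>C > 0\<close> by simp
  obtain \<delta> where "\<delta> > 0" and \<delta>: "\<forall>(m::nat) u v. (\<forall>i<m. a \<le> u i \<and> u i \<le> v i \<and> v i \<le> b) \<longrightarrow>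
        (\<forall>i<m. \<forall>j<m. i \<noteq> j \<longrightarrow> {u i<..<v i} \<inter> {u j<..<v j} = {}) \<longrightarrow>
        (\<Sum>i<m. v i - u i) < \<delta> \<longrightarrow> (\<Sum>i<m. norm (x (v i) - x (u i))) < \<epsilon> / (2 * C)"
    by (rule abs_continuous_onE[OF ac \<epsilon>'])
  have "(\<Sum>i<m. norm (y (v i) - y (u i))) < \<epsilon>"
    if uv: "\<forall>i<m. a \<le> u i \<and> u i \<le> v i \<and> v i \<le> b"
      "\<forall>i<m. \<forall>j<m. i \<noteq> j \<longrightarrow> {u i<..<v i} \<inter> {u j<..<v j} = {}"
      "(\<Sum>i<m. v i - u i) < min \<delta> (\<epsilon> / (2 * C))" for m :: nat and u v
  proof -
    have "(\<Sum>i<m. norm (y (v i) - y (u i))) \<le> (\<Sum>i<m. C * ((v i - u i) + norm (x (v i) - x (u i))))"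
      using uv(1) by (intro sum_mono le) auto
    also have "\<dots> = C * ((\<Sum>i<m. v i - u i) + (\<Sum>i<m. norm (x (v i) - x (u i))))"
      by (simp only: sum_distrib_left[symmetric] sum.distrib)
    also have "\<dots> < C * (\<epsilon> / (2 * C) + \<epsilon> / (2 * C))"
      using uv \<open>C > 0\<close> by (intro mult_strict_left_mono add_strict_mono \<delta>[rule_format]) auto
    also have "\<dots> = \<epsilon>" using \<open>C > 0\<close> by (simp add: field_simps)
    finally show ?thesis .
  qed
  then show "\<exists>\<delta>>0. \<forall>(m::nat) u v. (\<forall>i<m. a \<le> u i \<and> u i \<le> v i \<and> v i \<le> b) \<longrightarrow>
        (\<forall>i<m. \<forall>j<m. i \<noteq> j \<longrightarrow> {u i<..<v i} \<inter> {u j<..<v j} = {}) \<longrightarrow>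
        (\<Sum>i<m. v i - u i) < \<delta> \<longrightarrow> (\<Sum>i<m. norm (y (v i) - y (u i))) < \<epsilon>"
    using \<open>\<delta> > 0\<close> \<open>\<epsilon> / (2 * C) > 0\<close> by (intro exI[of _ "min \<delta> (\<epsilon> / (2 * C))"]) auto
qed

lemma abs_continuous_on_const: "abs_continuous_on a b (\<lambda>_. c)"
  unfolding abs_continuous_on_def by (auto intro: exI[of _ 1])

lemma lipschitz_imp_abs_continuous_on:
  assumes "M-lipschitz_on UNIV x"
  shows "abs_continuous_on a b x"
proof (rule abs_continuous_on_dominated[OF abs_continuous_on_const[of a b "0::real"], of x "M + 1"])
  fix u v :: real assume "u \<le> v"
  then show "norm (x v - x u) \<le> (M + 1) * ((v - u) + norm (0 - 0 :: real))"
    using lipschitz_onD[OF assms, of v u] by (simp add: dist_norm algebra_simps)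
qed (use lipschitz_on_nonneg[OF assms] in simp)

lemma abs_continuous_on_imp_continuous_on:
  assumes "abs_continuous_on a b x"
  shows "continuous_on {a..b} x"
  unfolding continuous_on_iff
proof (intro ballI allI impI)
  fix s \<epsilon> :: real assume s: "s \<in> {a..b}" and "\<epsilon> > 0"
  obtain \<delta> where "\<delta> > 0" and \<delta>: "\<forall>(m::nat) u v. (\<forall>i<m. a \<le> u i \<and> u i \<le> v i \<and> v i \<le> b) \<longrightarrow>
        (\<forall>i<m. \<forall>j<m. i \<noteq> j \<longrightarrow> {u i<..<v i} \<inter> {u j<..<v j} = {}) \<longrightarrow>
        (\<Sum>i<m. v i - u i) < \<delta> \<longrightarrow> (\<Sum>i<m. norm (x (v i) - x (u i))) < \<epsilon>"
    by (rule abs_continuous_onE[OF assms \<open>\<epsilon> > 0\<close>])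
  have *: "norm (x v - x u) < \<epsilon>" if "a \<le> u" "u \<le> v" "v \<le> b" "v - u < \<delta>" for u v
    using \<delta>[rule_format, of 1 "\<lambda>_. u" "\<lambda>_. v"] that by simp
  have "dist (x t) (x s) < \<epsilon>" if "t \<in> {a..b}" "dist t s < \<delta>" for t
    using *[of s t] *[of t s] that s
    by (cases "s \<le> t") (auto simp: dist_real_def dist_norm norm_minus_commute)
  then show "\<exists>d>0. \<forall>t\<in>{a..b}. dist t s < d \<longrightarrow> dist (x t) (x s) < \<epsilon>" using \<open>\<delta> > 0\<close> by blast
qed

text \<open>In a tagged division the tag may lie anywhere in its interval. Splitting the increment
  at t, the errors on the two sides add up to exactly \<open>e * (v - u)\<close>.\<close>

lemma straddle_nonpos:
  fixes \<phi> :: "real \<Rightarrow> real"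
  assumes "(\<phi> has_real_derivative D) (at t)" "D \<le> 0" "e > 0"
  shows "\<exists>r>0. \<forall>u v. t - r < u \<and> u \<le> t \<and> t \<le> v \<and> v < t + r \<longrightarrow> \<phi> v - \<phi> u \<le> e * (v - u)"
proof -
  obtain r where "r > 0" and r: "\<And>s. \<bar>s - t\<bar> < r \<Longrightarrow> \<bar>\<phi> s - \<phi> t - D * (s - t)\<bar> \<le> e * \<bar>s - t\<bar>"
    using assms(1,3) unfolding has_field_derivative_def has_derivative_at_alt by auto
  have "\<phi> v - \<phi> u \<le> e * (v - u)" if "t - r < u" "u \<le> t" "t \<le> v" "v < t + r" for u v
  proof -
    have "\<phi> v - \<phi> u \<le> e * (v - u) + D * (v - u)"
      using r[of u] r[of v] that by (simp add: algebra_simps abs_le_iff)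
    moreover have "D * (v - u) \<le> 0" using assms(2) that by (simp add: mult_nonpos_nonneg)
    ultimately show ?thesis by simp
  qed
  then show ?thesis using \<open>r > 0\<close> by blast
qed

text \<open>Cousin's lemma: at a good tag the increment is controlled by the derivative; the intervals
  with bad tags lie in an open set of small measure, so absolute continuity controls them.\<close>
lemma abs_continuous_on_nonincreasing:
  fixes \<phi> :: "real \<Rightarrow> real"
  assumes ac: "abs_continuous_on a b \<phi>" and "a \<le> b"
    and deriv: "AE t in lebesgue. t \<in> {a<..<b} \<longrightarrow> (\<exists>D\<le>0. (\<phi> has_real_derivative D) (at t))"
  shows "\<phi> b \<le> \<phi> a"
proof -
  have main: "\<phi> b - \<phi> a \<le> e * (b - a) + e" if "e > 0" for e
  proof -
    obtain \<delta> where "\<delta> > 0" and \<delta>: "\<forall>(m::nat) u v. (\<forall>i<m. a \<le> u i \<and> u i \<le> v i \<and> v i \<le> b) \<longrightarrow>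
        (\<forall>i<m. \<forall>j<m. i \<noteq> j \<longrightarrow> {u i<..<v i} \<inter> {u j<..<v j} = {}) \<longrightarrow>
        (\<Sum>i<m. v i - u i) < \<delta> \<longrightarrow> (\<Sum>i<m. norm (\<phi> (v i) - \<phi> (u i))) < e"
      by (rule abs_continuous_onE[OF ac \<open>e > 0\<close>])
    obtain Z0 where Z0: "negligible Z0"
      "\<And>t. t \<in> {a<..<b} - Z0 \<Longrightarrow> \<exists>D\<le>0. (\<phi> has_real_derivative D) (at t)"
    proof -
      obtain Z0 where "\<And>t. t \<in> space lebesgue - Z0 \<Longrightarrow> t \<in> {a<..<b} \<longrightarrow>
          (\<exists>D\<le>0. (\<phi> has_real_derivative D) (at t))" "Z0 \<in> null_sets lebesgue"
        using AE_E3[OF deriv] by blast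
      then show ?thesis using that[of Z0] by (simp add: negligible_iff_null_sets)
    qed
    \<comment> \<open>The endpoints count as bad tags because the derivative is assumed only in the
      open interval.\<close>
    define Z where "Z = Z0 \<union> {a, b}"
    have "negligible Z" using Z0(1) by (simp add: Z_def negligible_Un_eq)
    then obtain T where T: "open T" "Z \<subseteq> T" "T \<in> lmeasurable" "measure lebesgue T < \<delta>"
    proof -
      have Z: "Z \<in> null_sets lebesgue" using \<open>negligible Z\<close> by (simp add: negligible_iff_null_sets)
      obtain T where T: "open T" "Z \<subseteq> T" "(T - Z) \<in> lmeasurable" "emeasure lebesgue (T - Z) < ennreal \<delta>"
        using sets_lebesgue_outer_open[of Z \<delta>] Z \<open>\<delta> > 0\<close> by blast
      have "T \<in> sets lebesgue" using T(1) by (simp add: borel_open)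
      then have eq: "emeasure lebesgue T = emeasure lebesgue (T - Z)"
        using Z by (simp add: emeasure_Diff_null_set)
      have "T \<in> lmeasurable"
        using \<open>T \<in> sets lebesgue\<close> eq T(4) by (intro fmeasurableI) (auto simp: less_top[symmetric] intro: less_trans)
      moreover have "measure lebesgue T < \<delta>"
        using eq T(4) emeasure_eq_measure2[OF \<open>T \<in> lmeasurable\<close>] \<open>\<delta> > 0\<close>
        by (metis ennreal_less_iff measure_nonneg)
      ultimately show ?thesis using that T(1,2) by blast
    qed
    have "\<exists>r>0. \<forall>u v. t - r < u \<and> u \<le> t \<and> t \<le> v \<and> v < t + r \<longrightarrow> \<phi> v - \<phi> u \<le> e * (v - u)"
      if t: "t \<in> {a..b} - Z" for t
    proof -
      obtain D where "D \<le> 0" "(\<phi> has_real_derivative D) (at t)"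
        using Z0(2)[of t] t by (auto simp: Z_def less_le)
      then show ?thesis using straddle_nonpos \<open>e > 0\<close> by blast
    qed
    then have "\<forall>t. \<exists>r. t \<in> {a..b} - Z \<longrightarrow> r > 0 \<and>
        (\<forall>u v. t - r < u \<and> u \<le> t \<and> t \<le> v \<and> v < t + r \<longrightarrow> \<phi> v - \<phi> u \<le> e * (v - u))"
      by blast
    from choice[OF this] obtain r where rpos: "\<And>t. t \<in> {a..b} - Z \<Longrightarrow> r t > 0"
      and r: "\<And>t u v. t \<in> {a..b} - Z \<Longrightarrow> t - r t < u \<Longrightarrow> u \<le> t \<Longrightarrow> t \<le> v \<Longrightarrow> v < t + r t \<Longrightarrow>
        \<phi> v - \<phi> u \<le> e * (v - u)"
      by blast
    \<comment> \<open>Fineness confines an interval with a bad tag to T, and one with a good tag to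
      the range of the straddle estimate. The third case only makes \<open>\<gamma>\<close> a gauge
      on the whole line.\<close>
    define \<gamma> where "\<gamma> t = (if t \<in> Z then T else if t \<in> {a..b} then ball t (r t) else UNIV)" for t
    have "gauge \<gamma>" using T(1,2) rpos by (auto simp: gauge_def \<gamma>_def)
    then obtain p where p: "p tagged_division_of cbox a b" and fine: "\<gamma> fine p"
      using fine_division_exists by blast
    have pD: "\<exists>u v. K = {u..v} \<and> a \<le> u \<and> u \<le> t \<and> t \<le> v \<and> v \<le> b \<and> K \<subseteq> \<gamma> t \<and> Inf K = u \<and> Sup K = v"
      if tp: "(t, K) \<in> p" for t K
    proof -
      obtain u v where K: "K = cbox u v" using tagged_division_ofD(4)[OF p tp] by blast
      have tK: "t \<in> K" "K \<subseteq> cbox a b" "K \<subseteq> \<gamma> t"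
        using tagged_division_ofD(2,3)[OF p that] fineD[OF fine that] by auto
      then have uv: "u \<le> t" "t \<le> v" using K by auto
      moreover have "a \<le> u" "v \<le> b" using tK(2) K uv by auto
      ultimately show ?thesis using K tK(3) by (intro exI[of _ u] exI[of _ v]) auto
    qed
    define len where "len = (\<lambda>(t::real, K). Sup K - Inf K :: real)"
    define inc where "inc = (\<lambda>(t::real, K). \<phi> (Sup K) - \<phi> (Inf K))"
    define q where "q = {z \<in> p. fst z \<in> Z}"
    have "finite p" using p by blast
    then have "finite q" by (simp add: q_def)
    have total: "sum inc p = \<phi> b - \<phi> a" "sum len p = b - a"
      using additive_tagged_division_1[OF \<open>a \<le> b\<close>, of p \<phi>] additive_tagged_division_1[OF \<open>a \<le> b\<close>, of p "\<lambda>x. x"] p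
      by (simp_all add: inc_def len_def)
    have good: "inc z \<le> e * len z" if "z \<in> p - q" for z
    proof -
      obtain t K where z: "z = (t, K)" by force
      with that have tK: "(t, K) \<in> p" "t \<notin> Z" by (auto simp: q_def)
      obtain u v where uv: "K = {u..v}" "a \<le> u" "u \<le> t" "t \<le> v" "v \<le> b" "K \<subseteq> \<gamma> t" "Inf K = u" "Sup K = v"
        using pD[OF tK(1)] by blast
      then have "{u..v} \<subseteq> ball t (r t)" "u \<in> {u..v}" "v \<in> {u..v}" using tK(2) by (auto simp: \<gamma>_def)
      then have "u \<in> ball t (r t)" "v \<in> ball t (r t)" by blast+
      then have "\<phi> v - \<phi> u \<le> e * (v - u)"
        using uv tK(2) by (intro r[of t]) (auto simp: dist_real_def)
      then show ?thesis by (simp add: z inc_def len_def uv(7,8))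
    qed
    have len0: "len z \<ge> 0" if "z \<in> p" for z
      using pD[of "fst z" "snd z"] that by (cases z) (auto simp: len_def)
    have bad: "sum inc q \<le> e"
    proof -
      \<comment> \<open>The definition of absolute continuity speaks of families indexed by
        naturals, so the bad intervals are enumerated. Their interiors are disjoint and contained in
        T, hence their total length is below \<open>\<delta>\<close>.\<close>
      define m where "m = card q"
      obtain f where f: "bij_betw f {0..<m} q"
        using ex_bij_betw_nat_finite[OF \<open>finite q\<close>] m_def by blast
      then have f: "bij_betw f {..<m} q" by (simp add: lessThan_atLeast0)
      define u v where "u i = Inf (snd (f i))" and "v i = Sup (snd (f i))" for i
      have fi: "f i \<in> p \<and> fst (f i) \<in> Z" if "i < m" for i
        using bij_betwE[OF f] that by (auto simp: q_def)
      have K: "snd (f i) = {u i..v i} \<and> a \<le> u i \<and> u i \<le> v i \<and> v i \<le> b \<and> {u i..v i} \<subseteq> T" if "i < m" for i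
      proof -
        have "(fst (f i), snd (f i)) \<in> p" "fst (f i) \<in> Z" using fi[OF that] by auto
        moreover from pD[OF this(1)] obtain u' v' where "snd (f i) = {u'..v'}" "a \<le> u'" "u' \<le> fst (f i)"
            "fst (f i) \<le> v'" "v' \<le> b" "snd (f i) \<subseteq> \<gamma> (fst (f i))" "Inf (snd (f i)) = u'" "Sup (snd (f i)) = v'"
          by blast
        ultimately show ?thesis by (simp add: u_def v_def \<gamma>_def)
      qed
      have disj: "{u i<..<v i} \<inter> {u j<..<v j} = {}" if "i < m" "j < m" "i \<noteq> j" for i j
      proof -
        have "f i \<noteq> f j" using f that by (auto simp: bij_betw_def inj_on_def)
        then have "interior (snd (f i)) \<inter> interior (snd (f j)) = {}"
          using tagged_division_ofD(5)[OF p, of "fst (f i)" "snd (f i)" "fst (f j)" "snd (f j)"] fi that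
          by simp
        then show ?thesis using K that by simp
      qed
      have "(\<Sum>i<m. v i - u i) = (\<Sum>i<m. measure lebesgue {u i<..<v i})"
        using K by (intro sum.cong) auto
      also have "\<dots> = measure lebesgue (\<Union>i<m. {u i<..<v i})"
        using disj K by (intro measure_finite_Union[symmetric])
          (auto simp: disjoint_family_on_def)
      also have "\<dots> \<le> measure lebesgue T"
        using K T(3) by (intro measure_mono_fmeasurable) (force simp: subset_iff)+
      also have "\<dots> < \<delta>" by (rule T(4))
      finally have "(\<Sum>i<m. norm (\<phi> (v i) - \<phi> (u i))) < e"
        using K disj by (intro \<delta>[rule_format]) auto
      moreover have "sum inc q = (\<Sum>i<m. \<phi> (v i) - \<phi> (u i))"
        unfolding sum.reindex_bij_betw[OF f, symmetric]
        by (intro sum.cong) (auto simp: inc_def u_def v_def split: prod.splits)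
      moreover have "\<dots> \<le> (\<Sum>i<m. norm (\<phi> (v i) - \<phi> (u i)))" by (intro sum_mono) auto
      ultimately show ?thesis by simp
    qed
    have "\<phi> b - \<phi> a = sum inc (p - q) + sum inc q"
      unfolding total(1)[symmetric] using \<open>finite p\<close> by (intro sum.subset_diff) (auto simp: q_def)
    moreover have "sum inc (p - q) \<le> (\<Sum>z\<in>p - q. e * len z)" by (intro sum_mono good)
    moreover have "(\<Sum>z\<in>p - q. e * len z) \<le> (\<Sum>z\<in>p. e * len z)"
      using \<open>finite p\<close> len0 \<open>e > 0\<close> by (intro sum_mono2) auto
    moreover have "(\<Sum>z\<in>p. e * len z) = e * (b - a)" by (simp add: sum_distrib_left[symmetric] total)
    ultimately show ?thesis using bad by linarith
  qed
  have "\<phi> b - \<phi> a \<le> 0"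
  proof (rule field_le_epsilon)
    fix e :: real assume "e > 0"
    then have "e / (b - a + 1) > 0" using \<open>a \<le> b\<close> by simp
    from main[OF this] have "\<phi> b - \<phi> a \<le> e / (b - a + 1) * (b - a + 1)"
      by (simp only: distrib_left mult_1_right)
    then show "\<phi> b - \<phi> a \<le> 0 + e" using \<open>a \<le> b\<close> by simp
  qed
  then show ?thesis by simp
qed

text \<open>If the mean velocity were outside K, a hyperplane would separate it strictly from K. The
  scalar problem in the normal direction w then contradicts the monotonicity criterion.\<close>

lemma abs_continuous_on_mean_value:
  fixes x :: "real \<Rightarrow> 'a::euclidean_space"
  assumes ac: "abs_continuous_on a b x" and "a < b"
    and deriv: "AE t in lebesgue. t \<in> {a<..<b} \<longrightarrow> (\<exists>v\<in>K. (x has_vector_derivative v) (at t))"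
    and K: "convex K" "closed K"
  shows "(x b - x a) /\<^sub>R (b - a) \<in> K"
proof (rule ccontr)
  assume "(x b - x a) /\<^sub>R (b - a) \<notin> K"
  then obtain w c where w: "w \<bullet> ((x b - x a) /\<^sub>R (b - a)) < c" "\<And>v. v \<in> K \<Longrightarrow> w \<bullet> v > c"
    using separating_hyperplane_closed_point[OF K] by blast
  \<comment> \<open>Its derivative is \<open>c - w \<bullet> v < 0\<close> for velocities v in K,
    whereas the separation says that \<open>\<phi>\<close> increases from a to b.\<close>
  define \<phi> where "\<phi> t = c * t - w \<bullet> x t" for t
  have "\<phi> b \<le> \<phi> a"
  proof (rule abs_continuous_on_nonincreasing[of a b \<phi>])
    show "abs_continuous_on a b \<phi>"
    proof (rule abs_continuous_on_dominated[OF ac, of _ "\<bar>c\<bar> + norm w + 1"])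
      fix u v :: real assume "u \<le> v"
      have "\<bar>\<phi> v - \<phi> u\<bar> = \<bar>c * (v - u) - w \<bullet> (x v - x u)\<bar>"
        by (simp add: \<phi>_def algebra_simps inner_diff_right)
      also have "\<dots> \<le> \<bar>c * (v - u)\<bar> + \<bar>w \<bullet> (x v - x u)\<bar>" by simp
      also have "\<dots> \<le> \<bar>c\<bar> * (v - u) + norm w * norm (x v - x u)"
        using \<open>u \<le> v\<close> Cauchy_Schwarz_ineq2[of w "x v - x u"] by (simp add: abs_mult)
      also have "\<dots> \<le> (\<bar>c\<bar> + norm w + 1) * (v - u) + (\<bar>c\<bar> + norm w + 1) * norm (x v - x u)"
        using \<open>u \<le> v\<close> by (intro add_mono mult_right_mono) auto
      finally show "norm (\<phi> v - \<phi> u) \<le> (\<bar>c\<bar> + norm w + 1) * ((v - u) + norm (x v - x u))"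
        by (simp add: distrib_left)
    qed (simp add: add_nonneg_pos)
    show "AE t in lebesgue. t \<in> {a<..<b} \<longrightarrow> (\<exists>D\<le>0. (\<phi> has_real_derivative D) (at t))"
      using deriv
    proof eventually_elim
      case (elim t)
      show ?case
      proof
        assume "t \<in> {a<..<b}"
        then obtain v where v: "v \<in> K" "(x has_vector_derivative v) (at t)" using elim by blast
        have "((\<lambda>t. w \<bullet> x t) has_real_derivative w \<bullet> v) (at t)"
          using bounded_linear.has_vector_derivative[OF bounded_linear_inner_right v(2)]
          by (simp add: has_real_derivative_iff_has_vector_derivative)
        then have "(\<phi> has_real_derivative c - w \<bullet> v) (at t)"
          unfolding \<phi>_def by (auto intro!: derivative_eq_intros)
        then show "\<exists>D\<le>0. (\<phi> has_real_derivative D) (at t)" using w(2)[OF v(1)]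
          by (intro exI[of _ "c - w \<bullet> v"]) simp
      qed
    qed
  qed (use \<open>a < b\<close> in simp)
  then have "c * (b - a) \<le> w \<bullet> (x b - x a)" by (simp add: \<phi>_def inner_diff_right algebra_simps)
  moreover have "(w \<bullet> (x b - x a)) / (b - a) < c" using w(1) by (simp add: divide_inverse mult.commute)
  then have "w \<bullet> (x b - x a) < c * (b - a)" using \<open>a < b\<close> by (simp add: pos_divide_less_eq)
  ultimately show False by simp
qed

text \<open>A derivative that is already known to exist can be identified from one side; later only
  quotients to the right of t are compared with Euler increments.\<close>

lemma has_vector_derivative_quotient_tendsto:
  fixes x :: "real \<Rightarrow> 'a::real_normed_vector"
  assumes "(x has_vector_derivative v) (at t)"
  shows "((\<lambda>s. (x s - x t) /\<^sub>R (s - t)) \<longlongrightarrow> v) (at_right t)"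
proof -
  have "((\<lambda>s. norm (x s - x t - (s - t) *\<^sub>R v) / norm (s - t)) \<longlongrightarrow> 0) (at t)"
    using assms unfolding has_vector_derivative_def has_derivative_iff_norm by simp
  then have lim: "((\<lambda>s. norm (x s - x t - (s - t) *\<^sub>R v) / norm (s - t)) \<longlongrightarrow> 0) (at_right t)"
    by (rule filterlim_mono) (auto simp: at_le)
  have "norm (x s - x t - (s - t) *\<^sub>R v) / norm (s - t) = norm ((x s - x t) /\<^sub>R (s - t) - v)" if "t < s" for s
  proof -
    have "(x s - x t) /\<^sub>R (s - t) - v = (x s - x t - (s - t) *\<^sub>R v) /\<^sub>R (s - t)"
      using that by (simp add: scaleR_right_diff_distrib)
    then show ?thesis using that by (simp only: norm_scaleR) (simp add: divide_inverse mult.commute)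
  qed
  then have "\<forall>\<^sub>F s in at_right t. norm (x s - x t - (s - t) *\<^sub>R v) / norm (s - t)
      = norm ((x s - x t) /\<^sub>R (s - t) - v)"
    by (rule eventually_mono[OF eventually_at_right_less])
  from Lim_transform_eventually[OF lim this]
  show ?thesis by (simp add: tendsto_norm_zero_iff Lim_null[of _ v])
qed

lemma norm_le_of_quotient_in_cball:
  fixes z :: "'a::real_normed_vector"
  assumes "z /\<^sub>R d \<in> cball 0 C" "d > 0"
  shows "norm z \<le> C * d"
proof -
  have "norm z / d \<le> C" using assms by (simp add: divide_inverse mult.commute)
  then show ?thesis using assms(2) by (simp add: pos_divide_le_eq)
qed

section \<open>Thickenings, excess and interpolation\<close>

text \<open>The Minkowski sum with a closed ball: it inherits convexity from K, and closedness if K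
  is compact, as the mean value and limit arguments demand.\<close>

definition thickening :: "'a::real_normed_vector set \<Rightarrow> real \<Rightarrow> 'a set" where
  "thickening K e = {v. \<exists>u\<in>K. norm (v - u) \<le> e}"

lemma thickening_eq_sums: "thickening K e = (\<Union>u\<in>K. \<Union>w\<in>cball 0 e. {u + w})"
proof -
  have "norm (v - u) \<le> e \<longleftrightarrow> (\<exists>w\<in>cball 0 e. v = u + w)" for u v :: 'a
    using bexI[of "\<lambda>w. v = u + w" "v - u" "cball 0 e"] by auto
  then show ?thesis unfolding thickening_def by blast
qed

lemma convex_thickening: "convex K \<Longrightarrow> convex (thickening K e)"
  unfolding thickening_eq_sums by (intro convex_sums convex_cball)

lemma closed_thickening:
  fixes K :: "'a::euclidean_space set"
  assumes "compact K"
  shows "closed (thickening K e)"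
proof -
  have "thickening K e = {u + w |u w. u \<in> K \<and> w \<in> cball 0 e}"
    unfolding thickening_eq_sums by blast
  then show ?thesis using compact_sums[OF assms compact_cball[of 0 e]] compact_imp_closed by metis
qed

lemma mem_of_mem_thickenings:
  assumes "closed K" "\<And>e. e > 0 \<Longrightarrow> v \<in> thickening K e"
  shows "v \<in> K"
proof -
  have "\<exists>u\<in>K. dist u v < e" if "e > 0" for e
    using assms(2)[of "e / 2"] that by (force simp: thickening_def dist_norm norm_minus_commute)
  then have "v \<in> closure K" by (simp add: closure_approachable)
  then show ?thesis using assms(1) by simp
qed

text \<open>With relaxation parameter 0 the distance conditions of the scheme become membership. An
  empty B is ruled out by its infinite distance.\<close>

lemma point_dist_le_0_imp_mem:
  assumes "closed B" "point_dist a B \<le> ereal 0"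
  shows "a \<in> B"
proof -
  have "\<exists>b\<in>B. dist b a < e" if "e > 0" for e
  proof -
    have "(INF b\<in>B. ereal (norm (a - b))) < ereal e"
      using assms(2) that by (simp add: point_dist_def) (metis ereal_less(2) le_less_trans zero_ereal_def)
    then show ?thesis by (auto simp: INF_less_iff dist_norm norm_minus_commute)
  qed
  then have "a \<in> closure B" by (simp add: closure_approachable)
  then show ?thesis using assms(1) by simp
qed

lemma point_dist_mem: "a \<in> B \<Longrightarrow> point_dist a B \<le> ereal 0"
  unfolding point_dist_def by (rule INF_lower2[of a]) auto

text \<open>A nearest point exists by compactness. This turns the Lipschitz condition on F into the
  choice of a close velocity, the only form in which it is used afterwards.\<close>

lemma excess_compact_attained:
  fixes B :: "'a::euclidean_space set"
  assumes "excess K B \<le> ereal c" "compact B" "B \<noteq> {}" "v \<in> K"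
  shows "\<exists>w\<in>B. norm (v - w) \<le> c"
proof -
  obtain w where w: "w \<in> B" "\<And>b. b \<in> B \<Longrightarrow> dist v w \<le> dist v b"
    using distance_attains_inf[OF compact_imp_closed[OF assms(2)] assms(3), of v] by blast
  have "ereal (norm (v - w)) \<le> point_dist v B"
    unfolding point_dist_def using w(2) by (intro INF_greatest) (simp add: dist_norm)
  also have "\<dots> \<le> excess K B" unfolding excess_def using assms(4) by (rule SUP_upper)
  also have "\<dots> \<le> ereal c" by (rule assms(1))
  finally show ?thesis using w(1) by auto
qed

definition unit_clamp :: "real \<Rightarrow> real" where
  "unit_clamp u = max 0 (min 1 u)"

text \<open>Writing the interpolant as a sum of clamped increments makes its Lipschitz bound a
  telescoping identity.\<close>
definition interpolant :: "real \<Rightarrow> nat \<Rightarrow> (nat \<Rightarrow> 'a::real_vector) \<Rightarrow> real \<Rightarrow> 'a" where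
  "interpolant h \<nu> y t = y 0 + (\<Sum>n<\<nu>. unit_clamp (t / h - real n) *\<^sub>R (y (Suc n) - y n))"

text \<open>The clamps fill the interval from 0 to \<open>\<nu>\<close> one unit after another, so
  together they clamp to that interval.\<close>

lemma sum_unit_clamp: "(\<Sum>n<\<nu>. unit_clamp (u - real n)) = max 0 (min (real \<nu>) u)"
  by (induction \<nu>) (auto simp: unit_clamp_def min_def max_def)

text \<open>The clamp coefficients increase with time, so the norm of an increment is at most their
  total growth times \<open>M * h\<close>. By \<open>sum_unit_clamp\<close> this growth is at most
  \<open>(t - s) / h\<close>.\<close>

lemma interpolant_lipschitz:
  fixes y :: "nat \<Rightarrow> 'a::real_normed_vector"
  assumes "h > 0" "M \<ge> 0" and y: "\<And>n. n < \<nu> \<Longrightarrow> norm (y (Suc n) - y n) \<le> M * h"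
  shows "M-lipschitz_on UNIV (interpolant h \<nu> y)"
proof -
  have le: "norm (interpolant h \<nu> y t - interpolant h \<nu> y s) \<le> M * (t - s)" if "s \<le> t" for s t
  proof -
    define c where "c n = unit_clamp (t / h - real n) - unit_clamp (s / h - real n)" for n
    have "s / h \<le> t / h" using that assms(1) by (simp add: divide_right_mono)
    then have c0: "c n \<ge> 0" for n by (auto simp: c_def unit_clamp_def)
    have "interpolant h \<nu> y t - interpolant h \<nu> y s = (\<Sum>n<\<nu>. c n *\<^sub>R (y (Suc n) - y n))"
      by (simp add: interpolant_def c_def scaleR_left_diff_distrib sum_subtractf)
    also have "norm \<dots> \<le> (\<Sum>n<\<nu>. c n * (M * h))"
      using c0 y by (intro sum_norm_le) (auto intro: mult_left_mono)
    also have "\<dots> = (max 0 (min (real \<nu>) (t / h)) - max 0 (min (real \<nu>) (s / h))) * (M * h)"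
      by (simp only: sum_distrib_right[symmetric] c_def sum_subtractf sum_unit_clamp)
    also have "\<dots> \<le> (t / h - s / h) * (M * h)"
      using assms(1,2) \<open>s / h \<le> t / h\<close> by (intro mult_right_mono) (auto simp: min_def max_def)
    also have "\<dots> = M * (t - s)" using assms(1) by (simp add: field_simps)
    finally show ?thesis .
  qed
  show ?thesis
  proof (rule lipschitz_onI)
    show "dist (interpolant h \<nu> y t) (interpolant h \<nu> y s) \<le> M * dist t s" for s t
      using le[of s t] le[of t s]
      by (cases "s \<le> t") (auto simp: dist_norm norm_minus_commute)
  qed (rule assms(2))
qed

lemma interpolant_grid:
  assumes "h > 0" "m \<le> \<nu>"
  shows "interpolant h \<nu> y (real m * h) = y m"
proof -
  have "(\<Sum>n<\<nu>. unit_clamp (real m * h / h - real n) *\<^sub>R (y (Suc n) - y n))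
      = (\<Sum>n<\<nu>. if n < m then y (Suc n) - y n else 0)"
    using assms(1) by (intro sum.cong) (auto simp: unit_clamp_def min_def max_def)
  also have "\<dots> = (\<Sum>n<m. y (Suc n) - y n)"
    using assms(2) by (intro sum.mono_neutral_cong_right) auto
  also have "\<dots> = y m - y 0" by (rule sum_lessThan_telescope)
  finally show ?thesis by (simp add: interpolant_def)
qed

lemma floor_grid_bounds:
  assumes "h > 0" "t \<ge> 0"
  shows "real (nat \<lfloor>t / h\<rfloor>) * h \<le> t" "t - h < real (nat \<lfloor>t / h\<rfloor>) * h"
proof -
  have eq: "real (nat \<lfloor>t / h\<rfloor>) = of_int \<lfloor>t / h\<rfloor>" using assms by (simp add: of_nat_nat)
  have "of_int \<lfloor>t / h\<rfloor> * h \<le> t / h * h" using assms(1) by (intro mult_right_mono) auto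
  then show "real (nat \<lfloor>t / h\<rfloor>) * h \<le> t" using assms(1) eq by simp
  have "t / h - 1 < of_int \<lfloor>t / h\<rfloor>" by linarith
  then have "(t / h - 1) * h < of_int \<lfloor>t / h\<rfloor> * h" using assms(1) by (rule mult_strict_right_mono)
  then show "t - h < real (nat \<lfloor>t / h\<rfloor>) * h" using assms(1) eq by (simp add: left_diff_distrib)
qed

lemma floor_grid_tendsto:
  fixes h :: "nat \<Rightarrow> real"
  assumes "\<And>k. h k > 0" "h \<longlonglongrightarrow> 0" "t \<ge> 0"
  shows "(\<lambda>k. real (nat \<lfloor>t / h k\<rfloor>) * h k) \<longlonglongrightarrow> t"
proof (rule tendsto_sandwich)
  show "(\<lambda>k. t - h k) \<longlonglongrightarrow> t" using tendsto_diff[OF tendsto_const assms(2), of t] by simp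
  show "(\<lambda>k. t) \<longlonglongrightarrow> t" by simp
  show "\<forall>\<^sub>F k in sequentially. real (nat \<lfloor>t / h k\<rfloor>) * h k \<le> t"
    "\<forall>\<^sub>F k in sequentially. t - h k \<le> real (nat \<lfloor>t / h k\<rfloor>) * h k"
    using floor_grid_bounds[OF assms(1,3)] by (auto intro!: always_eventually less_imp_le)
qed

text \<open>The discrete counterpart of the mean value theorem: the mean velocity is the uniform
  average of the step velocities. The denominator is a difference of grid times because those
  converge separately.\<close>

lemma mean_increment_in_convex:
  fixes y :: "nat \<Rightarrow> 'a::real_vector"
  assumes "convex K" "n < m" "h > 0"
    and y: "\<And>j. n \<le> j \<Longrightarrow> j < m \<Longrightarrow> (y (Suc j) - y j) /\<^sub>R h \<in> K"
  shows "(y m - y n) /\<^sub>R (real m * h - real n * h) \<in> K"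
proof -
  have "(\<Sum>j\<in>{n..<m}. (1 / (real m - real n)) *\<^sub>R ((y (Suc j) - y j) /\<^sub>R h)) \<in> K"
    using assms(2) y by (intro convex_sum[OF _ assms(1)]) (auto simp: of_nat_diff)
  also have "(\<Sum>j\<in>{n..<m}. (1 / (real m - real n)) *\<^sub>R ((y (Suc j) - y j) /\<^sub>R h))
      = (1 / (real m - real n)) *\<^sub>R ((\<Sum>j\<in>{n..<m}. y (Suc j) - y j) /\<^sub>R h)"
    by (simp only: scaleR_sum_right)
  also have "(\<Sum>j\<in>{n..<m}. y (Suc j) - y j) = y m - y n"
    using assms(2) by (simp add: sum_Suc_diff')
  finally have "(1 / (real m - real n)) *\<^sub>R ((y m - y n) /\<^sub>R h) \<in> K" .
  moreover have "inverse (real m * h - real n * h) = (1 / (real m - real n)) * inverse h"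
    unfolding left_diff_distrib[symmetric] by (simp add: divide_inverse)
  ultimately show ?thesis by (simp only: scaleR_scaleR)
qed

lemma filterlim_at_top_of_ge:
  assumes "\<And>k. N k \<ge> (k :: nat)"
  shows "filterlim N at_top sequentially"
  by (rule filterlim_at_top_mono[OF filterlim_ident always_eventually]) (use assms in simp)

section \<open>Constrained differential inclusions\<close>

text \<open>P bounds the speed inside the balls of radius R around points of X0. The summand 1 in
  \<open>(P + 1) * T < R\<close> is room for the blowup of the Euler steps.\<close>
locale constrained_inclusion =
  fixes T L R P :: real
    and F :: "real \<Rightarrow> 'a::euclidean_space \<Rightarrow> 'a set"
    and A :: "real \<Rightarrow> 'a set"
    and X0 :: "'a set"
  assumes T_pos: "T > 0" and L_pos: "L > 0" and P_nonneg: "P \<ge> 0"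
    and F_convex: "\<And>t x. t \<in> {0..T} \<Longrightarrow> convex (F t x)"
    and F_compact: "\<And>t x. t \<in> {0..T} \<Longrightarrow> compact (F t x)"
    and F_lipschitz: "\<And>t t' x x' v. t \<in> {0..T} \<Longrightarrow> t' \<in> {0..T} \<Longrightarrow> v \<in> F t x \<Longrightarrow>
          \<exists>w\<in>F t' x'. norm (v - w) \<le> L * \<bar>t - t'\<bar> + L * norm (x - x')"
    and A_closed: "\<And>t. t \<in> {0..T} \<Longrightarrow> closed (A t)"
    and A_closed_graph: "\<And>s t z x. (\<And>n::nat. s n \<in> {0..T}) \<Longrightarrow> t \<in> {0..T} \<Longrightarrow> s \<longlonglongrightarrow> t \<Longrightarrow>
          (\<And>n. z n \<in> A (s n)) \<Longrightarrow> z \<longlonglongrightarrow> x \<Longrightarrow> x \<in> A t"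
    and X0_compact: "compact X0"
    and F_bounded: "\<And>t x z v. t \<in> {0..T} \<Longrightarrow> x \<in> X0 \<Longrightarrow> norm (z - x) \<le> R \<Longrightarrow> v \<in> F t z \<Longrightarrow> norm v \<le> P"
    and reach: "(P + 1) * T < R"
begin

abbreviation blowup :: "nat \<Rightarrow> real" where
  "blowup N \<equiv> L * (P + 1) * (step_size T N)\<^sup>2"

abbreviation euler :: "nat \<Rightarrow> nat \<Rightarrow> (nat \<Rightarrow> 'a) set" where
  "euler N \<nu> \<equiv> inflated_euler T F A X0 N \<nu> (blowup N) 0"

section \<open>Bounds for exact solutions and their sampling on the grid\<close>

lemma PT_less_R: "P * T < R"
  using reach T_pos by (simp add: algebra_simps)

lemma unconstrained_sol_AE:
  assumes "x \<in> unconstrained_sols F X0 \<tau>" "0 \<le> a" "b \<le> \<tau>"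
    and "\<And>t v. t \<in> {a<..<b} \<Longrightarrow> v \<in> F t (x t) \<Longrightarrow> v \<in> K"
  shows "AE t in lebesgue. t \<in> {a<..<b} \<longrightarrow> (\<exists>v\<in>K. (x has_vector_derivative v) (at t))"
proof -
  have "AE t in lebesgue. t \<in> {0<..<\<tau>} \<longrightarrow> (\<exists>v\<in>F t (x t). (x has_vector_derivative v) (at t))"
    using assms(1) by (simp add: unconstrained_sols_def)
  then show ?thesis
  proof eventually_elim
    case (elim t)
    show ?case
    proof
      assume t: "t \<in> {a<..<b}"
      then have "t \<in> {0<..<\<tau>}" using assms(2,3) by auto
      then show "\<exists>v\<in>K. (x has_vector_derivative v) (at t)" using elim assms(4)[OF t] by blast
    qed
  qed
qed

lemma unconstrained_sol_ac:
  "x \<in> unconstrained_sols F X0 \<tau> \<Longrightarrow> 0 \<le> a \<Longrightarrow> b \<le> \<tau> \<Longrightarrow> abs_continuous_on a b x"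
  unfolding unconstrained_sols_def by (blast intro: abs_continuous_on_subinterval)

text \<open>A first-exit argument. Before the first time \<open>t1\<close> at distance at least
  \<open>R\<close> the speed is at most \<open>P\<close>, so the distance at \<open>t1\<close> is at
  most \<open>P * T < R\<close>.\<close>

lemma unconstrained_sol_in_ball:
  assumes x: "x \<in> unconstrained_sols F X0 \<tau>" and "\<tau> \<le> T" "t \<in> {0..\<tau>}"
  shows "norm (x t - x 0) < R"
proof (rule ccontr)
  assume "\<not> norm (x t - x 0) < R"
  have "continuous_on {0..\<tau>} x"
    using unconstrained_sol_ac[OF x] abs_continuous_on_imp_continuous_on by blast
  then have cont: "continuous_on {0..\<tau>} (\<lambda>s. norm (x s - x 0))" by (intro continuous_intros)
  define E where "E = {0..\<tau>} \<inter> (\<lambda>s. norm (x s - x 0)) -` {R..}"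
  have "closed E" unfolding E_def by (intro continuous_closed_preimage cont) auto
  moreover have "E \<subseteq> {0..\<tau>}" by (auto simp: E_def)
  ultimately have "compact E" using compact_Int_closed[OF compact_Icc] by (metis inf.absorb_iff2)
  moreover have "t \<in> E" using assms(3) \<open>\<not> norm (x t - x 0) < R\<close> by (simp add: E_def)
  ultimately obtain t1 where t1: "t1 \<in> E" "\<And>s. s \<in> E \<Longrightarrow> t1 \<le> s"
    using compact_attains_inf[of E] by blast
  have "R > 0" using PT_less_R mult_nonneg_nonneg[of P T] P_nonneg T_pos by linarith
  then have "t1 > 0" "t1 \<le> \<tau>" "norm (x t1 - x 0) \<ge> R"
    using t1(1) by (auto simp: E_def le_less)
  have "AE s in lebesgue. s \<in> {0<..<t1} \<longrightarrow> (\<exists>v\<in>cball 0 P. (x has_vector_derivative v) (at s))"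
  proof (rule unconstrained_sol_AE[OF x])
    fix s v assume s: "s \<in> {0<..<t1}" and v: "v \<in> F s (x s)"
    have "s \<notin> E" using t1(2)[of s] s by auto
    then have "norm (x s - x 0) \<le> R" using s \<open>t1 \<le> \<tau>\<close> by (simp add: E_def)
    then show "v \<in> cball 0 P"
      using F_bounded[OF _ _ _ v, of "x 0"] s x \<open>t1 \<le> \<tau>\<close> \<open>\<tau> \<le> T\<close>
      by (auto simp: unconstrained_sols_def)
  qed (use \<open>t1 \<le> \<tau>\<close> in auto)
  from abs_continuous_on_mean_value[OF unconstrained_sol_ac[OF x] \<open>t1 > 0\<close> this]
  have "(x t1 - x 0) /\<^sub>R (t1 - 0) \<in> cball 0 P" using \<open>t1 \<le> \<tau>\<close> by simp
  then have "norm (x t1 - x 0) \<le> P * t1"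
    using norm_le_of_quotient_in_cball[where d = t1] \<open>t1 > 0\<close> by auto
  also have "\<dots> \<le> P * T" using \<open>t1 \<le> \<tau>\<close> \<open>\<tau> \<le> T\<close> P_nonneg by (intro mult_left_mono) auto
  finally show False using PT_less_R \<open>norm (x t1 - x 0) \<ge> R\<close> by simp
qed

lemma unconstrained_sol_speed:
  assumes x: "x \<in> unconstrained_sols F X0 \<tau>" and "\<tau> \<le> T" "0 \<le> s" "s \<le> t" "t \<le> \<tau>"
  shows "norm (x t - x s) \<le> P * (t - s)"
proof (cases "s = t")
  case False
  then have "s < t" using assms by simp
  have "AE r in lebesgue. r \<in> {s<..<t} \<longrightarrow> (\<exists>v\<in>cball 0 P. (x has_vector_derivative v) (at r))"
  proof (rule unconstrained_sol_AE[OF x])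
    fix r v assume r: "r \<in> {s<..<t}" and v: "v \<in> F r (x r)"
    have "norm (x r - x 0) \<le> R"
      using unconstrained_sol_in_ball[OF x \<open>\<tau> \<le> T\<close>, of r] r assms by auto
    then show "v \<in> cball 0 P"
      using F_bounded[OF _ _ _ v, of "x 0"] r x assms
      by (auto simp: unconstrained_sols_def)
  qed (use assms in auto)
  from abs_continuous_on_mean_value[OF unconstrained_sol_ac[OF x] \<open>s < t\<close> this]
  have "(x t - x s) /\<^sub>R (t - s) \<in> cball 0 P" using assms by simp
  then show ?thesis using norm_le_of_quotient_in_cball[where d = "t - s"] \<open>s < t\<close> by auto
qed simp

lemma step_size_pos: "N \<ge> 1 \<Longrightarrow> step_size T N > 0"
  using T_pos by (simp add: step_size_def)

lemma grid_pt_in: "N \<ge> 1 \<Longrightarrow> n \<le> N \<Longrightarrow> grid_pt T N n \<in> {0..T}"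
  using T_pos by (simp add: grid_pt_def step_size_def field_simps)

text \<open>During one step time changes by at most h and the state by at most \<open>P * h\<close>,
  so all velocities lie within \<open>L * (P + 1) * h\<close> of \<open>F a (x a)\<close>. Their
  mean stays in this convex closed thickening; multiplication by h turns the error into
  \<open>blowup N\<close>.\<close>

lemma sampled_sol_in_euler:
  assumes x: "x \<in> constrained_sols F A X0 \<tau>" and "\<tau> \<le> T" "N \<ge> 1" "grid_pt T N \<nu> \<le> \<tau>"
  shows "(\<lambda>n. x (grid_pt T N n)) \<in> euler N \<nu>"
proof -
  define h where "h = step_size T N"
  have h: "h > 0" using step_size_pos[OF \<open>N \<ge> 1\<close>] by (simp add: h_def)
  have xu: "x \<in> unconstrained_sols F X0 \<tau>" and xA: "\<And>t. t \<in> {0..\<tau>} \<Longrightarrow> x t \<in> A t"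
    using x by (auto simp: constrained_sols_def)
  have g: "0 \<le> grid_pt T N n" "grid_pt T N n \<le> \<tau>" if "n \<le> \<nu>" for n
  proof -
    have nh: "real n * h \<le> real \<nu> * h" using that h by (intro mult_right_mono) auto
    show "0 \<le> grid_pt T N n" "grid_pt T N n \<le> \<tau>" using order_trans[OF nh] assms(4) h unfolding grid_pt_def h_def[symmetric] by auto
  qed
  have "\<exists>v\<in>F (grid_pt T N n) (x (grid_pt T N n)). \<exists>b\<in>cball 0 (blowup N).
        x (grid_pt T N (Suc n)) = x (grid_pt T N n) + step_size T N *\<^sub>R v + b" if "n < \<nu>" for n
  proof -
    define a b where "a = grid_pt T N n" and "b = grid_pt T N (Suc n)"
    have ab: "b = a + h" "0 \<le> a" "b \<le> \<tau>"
      using g[of n] g[of "Suc n"] that by (auto simp: a_def b_def grid_pt_def h_def algebra_simps)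
    then have aT: "a \<in> {0..T}" using h \<open>\<tau> \<le> T\<close> by auto
    have "AE t in lebesgue. t \<in> {a<..<b} \<longrightarrow>
        (\<exists>v\<in>thickening (F a (x a)) (L * (P + 1) * h). (x has_vector_derivative v) (at t))"
    proof (rule unconstrained_sol_AE[OF xu ab(2,3)])
      fix t v assume t: "t \<in> {a<..<b}" and v: "v \<in> F t (x t)"
      have "t \<in> {0..T}" using t ab \<open>\<tau> \<le> T\<close> by auto
      then obtain w where w: "w \<in> F a (x a)" "norm (v - w) \<le> L * \<bar>t - a\<bar> + L * norm (x t - x a)"
        using F_lipschitz[OF _ aT v] by blast
      have "norm (x t - x a) \<le> P * (t - a)"
        using t ab by (intro unconstrained_sol_speed[OF xu \<open>\<tau> \<le> T\<close>]) auto
      also have "\<dots> \<le> P * h" using t ab P_nonneg by (intro mult_left_mono) auto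
      finally have "norm (x t - x a) \<le> P * h" .
      then have "L * norm (x t - x a) \<le> L * (P * h)" using L_pos by simp
      moreover have "L * \<bar>t - a\<bar> \<le> L * h" using t ab L_pos by simp
      ultimately have "norm (v - w) \<le> L * (P + 1) * h" using w(2) by (simp add: algebra_simps)
      then show "v \<in> thickening (F a (x a)) (L * (P + 1) * h)" using w(1) by (auto simp: thickening_def)
    qed
    from abs_continuous_on_mean_value[OF unconstrained_sol_ac[OF xu ab(2,3)] _ this
        convex_thickening[OF F_convex[OF aT]] closed_thickening[OF F_compact[OF aT]]]
    have "(x b - x a) /\<^sub>R h \<in> thickening (F a (x a)) (L * (P + 1) * h)" using h ab by simp
    then obtain u where u: "u \<in> F a (x a)" "norm ((x b - x a) /\<^sub>R h - u) \<le> L * (P + 1) * h"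
      by (auto simp: thickening_def)
    have "h *\<^sub>R ((x b - x a) /\<^sub>R h - u) = x b - x a - h *\<^sub>R u"
      using h by (simp add: scaleR_right_diff_distrib)
    then have "norm (x b - x a - h *\<^sub>R u) = h * norm ((x b - x a) /\<^sub>R h - u)"
      using h by (metis abs_of_pos norm_scaleR)
    also have "\<dots> \<le> h * (L * (P + 1) * h)" using u(2) h by (intro mult_left_mono) auto
    also have "\<dots> = blowup N" by (simp add: h_def power2_eq_square)
    finally show ?thesis
      using u(1) by (intro bexI[of _ u] bexI[of _ "x b - x a - h *\<^sub>R u"]) (auto simp: a_def b_def h_def)
  qed
  moreover have "x (grid_pt T N 0) \<in> X0" using xu by (simp add: grid_pt_def unconstrained_sols_def)
  moreover have "x (grid_pt T N n) \<in> A (grid_pt T N n)" if "n \<le> \<nu>" for n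
    using xA g[OF that] by simp
  ultimately show ?thesis
    using point_dist_mem by (auto simp: inflated_euler_def)
qed

lemma constrained_sols_antimono:
  "\<tau> \<le> \<tau>' \<Longrightarrow> constrained_sols F A X0 \<tau>' \<subseteq> constrained_sols F A X0 \<tau>"
proof
  fix x assume "\<tau> \<le> \<tau>'" and x: "x \<in> constrained_sols F A X0 \<tau>'"
  then have "x \<in> unconstrained_sols F X0 \<tau>'" by (simp add: constrained_sols_def)
  then have "abs_continuous_on 0 \<tau> x" "x 0 \<in> X0"
    "AE t in lebesgue. t \<in> {0<..<\<tau>'} \<longrightarrow> (\<exists>v\<in>F t (x t). (x has_vector_derivative v) (at t))"
    using unconstrained_sol_ac[of x \<tau>' 0 \<tau>] \<open>\<tau> \<le> \<tau>'\<close> by (simp_all add: unconstrained_sols_def)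
  moreover from this(3) have
    "AE t in lebesgue. t \<in> {0<..<\<tau>} \<longrightarrow> (\<exists>v\<in>F t (x t). (x has_vector_derivative v) (at t))"
    by eventually_elim (use \<open>\<tau> \<le> \<tau>'\<close> in auto)
  ultimately show "x \<in> constrained_sols F A X0 \<tau>"
    using x \<open>\<tau> \<le> \<tau>'\<close> by (auto simp: constrained_sols_def unconstrained_sols_def)
qed

section \<open>Bounds and compactness for Euler sequences\<close>

definition fine_count :: nat where
  "fine_count = nat \<lceil>L * (P + 1) * T\<rceil> + 1"

text \<open>From this threshold on the blowup adds at most 1 to the speed, matching the
  \<open>P + 1\<close> in \<open>reach\<close>. The final summand in \<open>fine_count\<close>
  excludes N = 0, where the step size would be a division by zero.\<close>

lemma fine_count:
  assumes "N \<ge> fine_count"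
  shows "N \<ge> 1" "step_size T N > 0" "L * (P + 1) * step_size T N \<le> 1"
proof -
  show "N \<ge> 1" using assms by (simp add: fine_count_def)
  then show "step_size T N > 0" by (rule step_size_pos)
  have "L * (P + 1) * T \<le> real N" using assms unfolding fine_count_def by linarith
  then show "L * (P + 1) * step_size T N \<le> 1" using \<open>N \<ge> 1\<close> by (simp add: step_size_def field_simps)
qed

lemma euler_initial: "y \<in> euler N \<nu> \<Longrightarrow> y 0 \<in> X0"
  using point_dist_le_0_imp_mem[OF compact_imp_closed[OF X0_compact]] by (simp add: inflated_euler_def)

lemma euler_constraint:
  assumes "y \<in> euler N \<nu>" "N \<ge> 1" "\<nu> \<le> N" "n \<le> \<nu>"
  shows "y n \<in> A (grid_pt T N n)"
proof (rule point_dist_le_0_imp_mem)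
  show "closed (A (grid_pt T N n))" using assms grid_pt_in[of N n] by (intro A_closed) simp
  show "point_dist (y n) (A (grid_pt T N n)) \<le> ereal 0" using assms by (simp add: inflated_euler_def)
qed

lemma euler_step:
  assumes y: "y \<in> euler N \<nu>" and "N \<ge> 1" "n < \<nu>"
  obtains v where "v \<in> F (grid_pt T N n) (y n)"
    "norm ((y (Suc n) - y n) /\<^sub>R step_size T N - v) \<le> L * (P + 1) * step_size T N"
proof -
  define h where "h = step_size T N"
  have h: "h > 0" using step_size_pos[OF \<open>N \<ge> 1\<close>] by (simp add: h_def)
  obtain v b where v: "v \<in> F (grid_pt T N n) (y n)" and b: "norm b \<le> L * (P + 1) * h\<^sup>2"
    and eq: "y (Suc n) = y n + h *\<^sub>R v + b"
    using y \<open>n < \<nu>\<close> unfolding inflated_euler_def h_def by auto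
  have "(y (Suc n) - y n) /\<^sub>R h - v = b /\<^sub>R h"
    using h by (simp add: eq algebra_simps)
  then have "norm ((y (Suc n) - y n) /\<^sub>R h - v) = norm b / h" using h by (simp add: divide_inverse mult.commute)
  also have "\<dots> \<le> L * (P + 1) * h\<^sup>2 / h" using b h by (simp add: divide_right_mono)
  also have "\<dots> = L * (P + 1) * h" using h by (simp add: power2_eq_square)
  finally show ?thesis using that v by (simp add: h_def)
qed

text \<open>A discrete continuation argument: if the first m steps obey the bound,
  \<open>reach\<close> keeps \<open>y m\<close> within \<open>R\<close> of \<open>y 0\<close>, so
  \<open>F_bounded\<close> applies to the next velocity. The blowup then raises the speed from
  \<open>P\<close> to at most \<open>P + 1\<close>.\<close>

lemma euler_increment:
  assumes y: "y \<in> euler N \<nu>" and N: "N \<ge> fine_count" and "\<nu> \<le> N" "n < \<nu>"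
  shows "norm (y (Suc n) - y n) \<le> (P + 1) * step_size T N"
proof -
  define h where "h = step_size T N"
  note fc = fine_count[OF N]
  have h: "h > 0" using fc by (simp add: h_def)
  have step: "norm (y (Suc m) - y m) \<le> (P + 1) * h" if "m < \<nu>" "norm (y m - y 0) \<le> R" for m
  proof -
    obtain v where v: "v \<in> F (grid_pt T N m) (y m)"
      "norm ((y (Suc m) - y m) /\<^sub>R h - v) \<le> L * (P + 1) * h"
      using euler_step[OF y fc(1) \<open>m < \<nu>\<close>] unfolding h_def by blast
    have "norm v \<le> P"
      using F_bounded[OF _ euler_initial[OF y] that(2) v(1)] grid_pt_in[OF fc(1)] that(1) \<open>\<nu> \<le> N\<close> by simp
    then have "norm ((y (Suc m) - y m) /\<^sub>R h) \<le> P + 1"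
      using v(2) fc(3) norm_triangle_sub[of "(y (Suc m) - y m) /\<^sub>R h" v] unfolding h_def by linarith
    then show ?thesis using norm_le_of_quotient_in_cball[where d = h] h by simp
  qed
  have stay: "norm (y m - y 0) \<le> R" if "(P + 1) * (real m * h) \<ge> norm (y m - y 0)" "m \<le> \<nu>" for m
  proof -
    have "real m * h \<le> T" using grid_pt_in[OF fc(1), of m] that(2) \<open>\<nu> \<le> N\<close> by (simp add: grid_pt_def h_def)
    then have "(P + 1) * (real m * h) \<le> (P + 1) * T" using P_nonneg by (intro mult_left_mono) auto
    then show ?thesis using reach that(1) by simp
  qed
  have "m \<le> \<nu> \<longrightarrow> norm (y m - y 0) \<le> (P + 1) * (real m * h)" for m
  proof (induction m)
    case (Suc m)
    show ?case
    proof
      assume m: "Suc m \<le> \<nu>"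
      then have IH: "norm (y m - y 0) \<le> (P + 1) * (real m * h)" using Suc by simp
      have "norm (y (Suc m) - y m) \<le> (P + 1) * h" using step stay[OF IH] m by simp
      moreover have "norm (y (Suc m) - y 0) \<le> norm (y (Suc m) - y m) + norm (y m - y 0)"
        using norm_triangle_ineq[of "y (Suc m) - y m" "y m - y 0"] by simp
      moreover have "(P + 1) * h + (P + 1) * (real m * h) = (P + 1) * (real (Suc m) * h)"
        by (simp add: algebra_simps)
      ultimately show "norm (y (Suc m) - y 0) \<le> (P + 1) * (real (Suc m) * h)" using IH by linarith
    qed
  qed simp
  then show ?thesis using step stay \<open>n < \<nu>\<close> by (simp add: h_def)
qed

text \<open>An interpolant is constant after its last node, so all of them can be compared on the
  fixed interval from 0 to T although \<open>\<nu> k\<close> varies.\<close>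

lemma euler_limit_exists:
  assumes N: "\<And>k. N k \<ge> fine_count" and \<nu>: "\<And>k. \<nu> k \<le> N k"
    and y: "\<And>k. y k \<in> euler (N k) (\<nu> k)"
  obtains r x where "strict_mono (r :: nat \<Rightarrow> nat)" "(P + 1)-lipschitz_on UNIV x"
    "\<forall>e>0. \<exists>K. \<forall>k\<ge>K. \<forall>n\<le>\<nu> (r k). norm (y (r k) n - x (grid_pt T (N (r k)) n)) < e"
proof -
  define X where "X k = interpolant (step_size T (N k)) (\<nu> k) (y k)" for k
  have hpos: "step_size T (N k) > 0" for k using fine_count(2)[OF N] .
  have Xlip: "(P + 1)-lipschitz_on UNIV (X k)" for k
    unfolding X_def using P_nonneg euler_increment[OF y N \<nu>] by (intro interpolant_lipschitz hpos) auto
  have lipD: "norm (X k s - X k t) \<le> (P + 1) * \<bar>s - t\<bar>" for k s t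
    using lipschitz_onD[OF Xlip, of s t] by (simp add: dist_norm)
  have Xgrid: "X k (grid_pt T (N k) n) = y k n" if "n \<le> \<nu> k" for k n
    using interpolant_grid[OF hpos that] by (simp add: X_def grid_pt_def)
  obtain B where B: "\<And>z. z \<in> X0 \<Longrightarrow> norm z \<le> B"
    using compact_imp_bounded[OF X0_compact] bounded_iff by blast
  have bound: "norm (X k t) \<le> B + (P + 1) * T" if "t \<in> {0..T}" for k t
  proof -
    have "X k 0 = y k 0" using Xgrid[of 0 k] by (simp add: grid_pt_def)
    then have "norm (X k 0) \<le> B" using B euler_initial[OF y] by simp
    moreover have "norm (X k t - X k 0) \<le> (P + 1) * T"
      using lipD[of k t 0] that P_nonneg by (smt (verit) atLeastAtMost_iff mult_left_mono)
    ultimately show ?thesis using norm_triangle_sub[of "X k t" "X k 0"] by linarith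
  qed
  have equicont: "\<exists>d. 0 < d \<and> (\<forall>n t. t \<in> {0..T} \<and> norm (s - t) < d \<longrightarrow> norm (X n s - X n t) < e)"
    if "0 < e" for s e
  proof (intro exI conjI allI impI)
    show "0 < e / (P + 1)" using that P_nonneg by simp
    fix n t assume "t \<in> {0..T} \<and> norm (s - t) < e / (P + 1)"
    then have "(P + 1) * \<bar>s - t\<bar> < e" using P_nonneg by (simp add: pos_less_divide_eq mult.commute)
    then show "norm (X n s - X n t) < e" using lipD[of n s t] by linarith
  qed
  obtain g r where r: "strict_mono (r :: nat \<Rightarrow> nat)"
    and g: "\<And>e. 0 < e \<Longrightarrow> \<exists>K. \<forall>n s. n \<ge> K \<and> s \<in> {0..T} \<longrightarrow> norm (X (r n) s - g s) < e"
    using Arzela_Ascoli[OF compact_Icc[of 0 T] bound equicont] by metis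
  \<comment> \<open>Arzela-Ascoli controls the limit on the compact interval only. Constant
    continuation makes it Lipschitz on the whole line, as \<open>lipschitz_differentiable_ae\<close>
    expects.\<close>
  define x where "x t = g (max 0 (min T t))" for t
  have gx: "x t = g t" if "t \<in> {0..T}" for t using that by (simp add: x_def max_def)
  have lim: "(\<lambda>n. X (r n) s) \<longlonglongrightarrow> g s" if "s \<in> {0..T}" for s
    unfolding LIMSEQ_def dist_norm using g that by blast
  have glip: "norm (g s - g t) \<le> (P + 1) * \<bar>s - t\<bar>" if "s \<in> {0..T}" "t \<in> {0..T}" for s t
    by (rule tendsto_upperbound[OF tendsto_norm[OF tendsto_diff[OF lim[OF that(1)] lim[OF that(2)]]]])
      (use lipD in \<open>auto intro: always_eventually\<close>)
  show ?thesis
  proof (rule that[OF r])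
    show "(P + 1)-lipschitz_on UNIV x"
    proof (rule lipschitz_onI)
      fix s t :: real
      have "norm (x s - x t) \<le> (P + 1) * \<bar>max 0 (min T s) - max 0 (min T t)\<bar>"
        unfolding x_def using T_pos by (intro glip) auto
      also have "\<dots> \<le> (P + 1) * \<bar>s - t\<bar>"
        using P_nonneg by (intro mult_left_mono) (auto simp: max_def min_def)
      finally show "dist (x s) (x t) \<le> (P + 1) * dist s t" by (simp add: dist_norm)
    qed (use P_nonneg in simp)
    show "\<forall>e>0. \<exists>K. \<forall>k\<ge>K. \<forall>n\<le>\<nu> (r k). norm (y (r k) n - x (grid_pt T (N (r k)) n)) < e"
    proof (intro allI impI)
      fix e :: real assume "e > 0"
      then obtain K where K: "\<And>n s. n \<ge> K \<Longrightarrow> s \<in> {0..T} \<Longrightarrow> norm (X (r n) s - g s) < e" using g by blast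
      have "norm (y (r k) n - x (grid_pt T (N (r k)) n)) < e" if "k \<ge> K" "n \<le> \<nu> (r k)" for k n
      proof -
        have "grid_pt T (N (r k)) n \<in> {0..T}"
          using grid_pt_in[OF fine_count(1)[OF N]] that(2) \<nu>[of "r k"] by simp
        then show ?thesis using K[OF that(1)] Xgrid[OF that(2)] gx by metis
      qed
      then show "\<exists>K. \<forall>k\<ge>K. \<forall>n\<le>\<nu> (r k). norm (y (r k) n - x (grid_pt T (N (r k)) n)) < e" by blast
    qed
  qed
qed

text \<open>For fixed s slightly above t, the quotient of x is a limit of mean Euler velocities
  between the grid indices of t and s. Each step velocity is within e of \<open>F t (x t)\<close>;
  convexity carries this to the mean, closedness to k tending to infinity and then to s tending to
  t.\<close>

lemma euler_limit_derivative:
  assumes N: "\<And>k. N k \<ge> fine_count" and h0: "(\<lambda>k. step_size T (N k)) \<longlonglongrightarrow> 0"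
    and \<nu>: "\<And>k. \<nu> k \<le> N k" and \<tau>: "(\<lambda>k. grid_pt T (N k) (\<nu> k)) \<longlonglongrightarrow> \<tau>"
    and y: "\<And>k. y k \<in> euler (N k) (\<nu> k)"
    and xlip: "(P + 1)-lipschitz_on UNIV x"
    and conv: "\<And>e. e > 0 \<Longrightarrow> \<forall>\<^sub>F k in sequentially. \<forall>n\<le>\<nu> k. norm (y k n - x (grid_pt T (N k) n)) < e"
    and t: "t \<in> {0<..<\<tau>}" "t \<le> T" and v: "(x has_vector_derivative v) (at t)"
  shows "v \<in> F t (x t)"
proof -
  have tT: "t \<in> {0..T}" using t by simp
  define h where "h k = step_size T (N k)" for k
  have hpos: "h k > 0" for k unfolding h_def using fine_count(2)[OF N] .
  have h0: "h \<longlonglongrightarrow> 0" using h0 by (simp add: h_def[abs_def])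
  have \<tau>: "(\<lambda>k. real (\<nu> k) * h k) \<longlonglongrightarrow> \<tau>" using \<tau> by (simp add: grid_pt_def h_def)
  have lipD: "norm (x a - x b) \<le> (P + 1) * \<bar>a - b\<bar>" for a b
    using lipschitz_onD[OF xlip, of a b] by (simp add: dist_norm)
  show ?thesis
  proof (rule mem_of_mem_thickenings)
    show "closed (F t (x t))" using F_compact[OF tT] by (rule compact_imp_closed)
    fix e :: real assume "e > 0"
    \<comment> \<open>The factor \<open>P + 2\<close> collects 1 from the time dependence of F and
      \<open>P + 1\<close> from the motion of x. The error budget is e/2 for \<open>\<eta>\<close>
      and e/8 each for grid rounding, uniform convergence and blowup. The bound
      \<open>\<tau> - t\<close> keeps s strictly before the end time.\<close>
    define \<eta> where "\<eta> = min (\<tau> - t) (e / (2 * (L * (P + 2))))"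
    have "\<eta> > 0" using t \<open>e > 0\<close> L_pos P_nonneg by (simp add: \<eta>_def)
    have \<eta>: "L * (P + 2) * \<eta> \<le> e / 2"
    proof -
      have "L * (P + 2) * \<eta> \<le> L * (P + 2) * (e / (2 * (L * (P + 2))))"
        using L_pos P_nonneg by (intro mult_left_mono) (auto simp: \<eta>_def)
      also have "L * (P + 2) * (e / (2 * (L * (P + 2)))) = e / 2"
        using nonzero_mult_div_cancel_left[of "L * (P + 2)" "e / 2"] L_pos P_nonneg
        by (simp del: nonzero_mult_div_cancel_left)
      finally show ?thesis .
    qed
    have close: "closed (thickening (F t (x t)) e)" using closed_thickening F_compact[OF tT] by blast
    have "(x s - x t) /\<^sub>R (s - t) \<in> thickening (F t (x t)) e" if s: "t < s" "s < t + \<eta>" for s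
    proof -
      define n m where "n k = nat \<lfloor>t / h k\<rfloor>" and "m k = nat \<lfloor>s / h k\<rfloor>" for k
      have "s < \<tau>" using s by (simp add: \<eta>_def)
      have nt: "(\<lambda>k. real (n k) * h k) \<longlonglongrightarrow> t"
        unfolding n_def using t by (intro floor_grid_tendsto hpos h0) auto
      have ms: "(\<lambda>k. real (m k) * h k) \<longlonglongrightarrow> s"
        unfolding m_def using t s by (intro floor_grid_tendsto hpos h0) auto
      have e1: "\<forall>\<^sub>F k in sequentially. real (m k) * h k - real (n k) * h k > 0"
        using order_tendstoD(1)[OF tendsto_diff[OF ms nt], of 0] s by simp
      have e2: "\<forall>\<^sub>F k in sequentially. real (\<nu> k) * h k - real (m k) * h k > 0"
        using order_tendstoD(1)[OF tendsto_diff[OF \<tau> ms], of 0] \<open>s < \<tau>\<close> by simp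
      have e3: "\<forall>\<^sub>F k in sequentially. h k < e / (8 * L * (P + 2))"
        using order_tendstoD(2)[OF h0] \<open>e > 0\<close> L_pos P_nonneg by simp
      have e4: "\<forall>\<^sub>F k in sequentially. \<forall>n\<le>\<nu> k. norm (y k n - x (grid_pt T (N k) n)) < e / (8 * L)"
        using conv \<open>e > 0\<close> L_pos by simp
      have quot: "\<forall>\<^sub>F k in sequentially. (y k (m k) - y k (n k)) /\<^sub>R (real (m k) * h k - real (n k) * h k)
          \<in> thickening (F t (x t)) e"
        using e1 e2 e3 e4
      proof eventually_elim
        case (elim k)
        have nm: "n k < m k" using elim(1) hpos[of k] by simp
        have m\<nu>: "m k < \<nu> k" using elim(2) hpos[of k] by simp
        have "8 * L * (P + 2) > 0" using L_pos P_nonneg by simp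
        then have "h k * (8 * L * (P + 2)) < e" using elim(3) by (simp only: pos_less_divide_eq)
        then have hk: "L * (P + 2) * h k \<le> e / 8" by (simp add: algebra_simps)
        show ?case
        proof (rule mean_increment_in_convex[OF convex_thickening[OF F_convex[OF tT]] nm hpos])
          fix j assume j: "n k \<le> j" "j < m k"
          then have "j < \<nu> k" using m\<nu> by simp
          define p where "p = grid_pt T (N k) j"
          have pT: "p \<in> {0..T}" unfolding p_def
            using grid_pt_in[OF fine_count(1)[OF N]] \<open>j < \<nu> k\<close> \<nu>[of k] by simp
          have "real (n k) * h k \<le> p" "p \<le> real (m k) * h k"
            unfolding p_def grid_pt_def h_def[symmetric] using j hpos[of k] by (auto intro: mult_right_mono)
          \<comment> \<open>Rounding down may place the first node before t, by less than one
            step.\<close>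
          then have "t - h k < p" "p \<le> s"
            using floor_grid_bounds[OF hpos, of t k] floor_grid_bounds[OF hpos, of s k] t s
            unfolding n_def m_def by auto
          then have pt: "\<bar>p - t\<bar> \<le> \<eta> + h k" using s \<open>\<eta> > 0\<close> hpos[of k] by auto
          obtain u where u: "u \<in> F p (y k j)"
            "norm ((y k (Suc j) - y k j) /\<^sub>R h k - u) \<le> L * (P + 1) * h k"
            using euler_step[OF y fine_count(1)[OF N] \<open>j < \<nu> k\<close>] unfolding h_def p_def by blast
          obtain w where w: "w \<in> F t (x t)" "norm (u - w) \<le> L * \<bar>p - t\<bar> + L * norm (y k j - x t)"
            using F_lipschitz[OF pT tT u(1)] by blast
          have "norm (y k j - x p) < e / (8 * L)" using elim(4) \<open>j < \<nu> k\<close> by (simp add: p_def)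
          moreover have "norm (y k j - x t) \<le> norm (y k j - x p) + norm (x p - x t)"
            using norm_triangle_ineq[of "y k j - x p" "x p - x t"] by simp
          ultimately have "norm (y k j - x t) \<le> e / (8 * L) + (P + 1) * \<bar>p - t\<bar>"
            using lipD[of p t] by linarith
          then have "L * norm (y k j - x t) \<le> L * (e / (8 * L) + (P + 1) * \<bar>p - t\<bar>)"
            using L_pos by simp
          also have "\<dots> = e / 8 + L * (P + 1) * \<bar>p - t\<bar>" using L_pos by (simp add: distrib_left)
          finally have "norm (u - w) \<le> e / 8 + L * (P + 2) * \<bar>p - t\<bar>"
            using w(2) by (simp add: algebra_simps)
          also have "L * (P + 2) * \<bar>p - t\<bar> \<le> L * (P + 2) * (\<eta> + h k)"
            using pt L_pos P_nonneg by (intro mult_left_mono) auto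
          also have "\<dots> = L * (P + 2) * \<eta> + L * (P + 2) * h k" by (rule distrib_left)
          finally have "norm (u - w) \<le> e / 8 + (e / 2 + e / 8)" using \<eta> hk by linarith
          moreover have "L * (P + 1) * h k \<le> L * (P + 2) * h k"
            using L_pos hpos[of k] by (simp add: mult_right_mono)
          moreover have "norm ((y k (Suc j) - y k j) /\<^sub>R h k - w)
              \<le> norm ((y k (Suc j) - y k j) /\<^sub>R h k - u) + norm (u - w)"
            using norm_triangle_ineq[of "(y k (Suc j) - y k j) /\<^sub>R h k - u" "u - w"] by simp
          ultimately have "norm ((y k (Suc j) - y k j) /\<^sub>R h k - w) \<le> e"
            using u(2) hk \<open>e > 0\<close> by linarith
          then show "(y k (Suc j) - y k j) /\<^sub>R h k \<in> thickening (F t (x t)) e"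
            using w(1) by (auto simp: thickening_def)
        qed
      qed
      have ylim: "(\<lambda>k. y k (q k)) \<longlonglongrightarrow> x a"
        if q: "\<forall>\<^sub>F k in sequentially. q k \<le> \<nu> k" and qa: "(\<lambda>k. real (q k) * h k) \<longlonglongrightarrow> a" for q a
      proof -
        have "(\<lambda>k. x (real (q k) * h k)) \<longlonglongrightarrow> x a"
      using isCont_tendsto_compose[OF _ qa, of x] lipschitz_on_continuous_on[OF xlip]
      by (simp add: continuous_on_eq_continuous_at)
        moreover have "(\<lambda>k. y k (q k) - x (real (q k) * h k)) \<longlonglongrightarrow> 0"
        proof (rule tendstoI)
          fix e' :: real assume "e' > 0"
          from eventually_conj[OF q conv[OF this]]
          show "\<forall>\<^sub>F k in sequentially. dist (y k (q k) - x (real (q k) * h k)) 0 < e'"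
            by eventually_elim (auto simp: grid_pt_def h_def)
        qed
        ultimately show ?thesis using tendsto_add by fastforce
      qed
      have m\<nu>: "\<forall>\<^sub>F k in sequentially. m k \<le> \<nu> k"
        using e2
      proof eventually_elim
        case (elim k)
        then show ?case using hpos[of k] by simp
      qed
      have n\<nu>: "\<forall>\<^sub>F k in sequentially. n k \<le> \<nu> k"
        using m\<nu> e1
      proof eventually_elim
        case (elim k)
        then show ?case using hpos[of k] by simp
      qed
      have "(\<lambda>k. (y k (m k) - y k (n k)) /\<^sub>R (real (m k) * h k - real (n k) * h k))
          \<longlonglongrightarrow> (x s - x t) /\<^sub>R (s - t)"
        using s by (intro tendsto_intros ylim m\<nu> n\<nu> ms nt) auto
      from Lim_in_closed_set[OF close quot _ this] show ?thesis by simp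
    qed
    then have "\<forall>\<^sub>F s in at_right t. (x s - x t) /\<^sub>R (s - t) \<in> thickening (F t (x t)) e"
      unfolding eventually_at_right_field using \<open>\<eta> > 0\<close> by (intro exI[of _ "t + \<eta>"]) auto
    from Lim_in_closed_set[OF close this _ has_vector_derivative_quotient_tendsto[OF v]]
    show "v \<in> thickening (F t (x t)) e" by simp
  qed
qed

lemma euler_limit_is_constrained_sol:
  assumes N: "\<And>k. N k \<ge> fine_count" and h0: "(\<lambda>k. step_size T (N k)) \<longlonglongrightarrow> 0"
    and \<nu>: "\<And>k. \<nu> k \<le> N k" and \<tau>: "(\<lambda>k. grid_pt T (N k) (\<nu> k)) \<longlonglongrightarrow> \<tau>" and "\<tau> \<in> {0..T}"
    and y: "\<And>k. y k \<in> euler (N k) (\<nu> k)"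
    and xlip: "(P + 1)-lipschitz_on UNIV x"
    and conv: "\<And>e. e > 0 \<Longrightarrow> \<forall>\<^sub>F k in sequentially. \<forall>n\<le>\<nu> k. norm (y k n - x (grid_pt T (N k) n)) < e"
  shows "x \<in> constrained_sols F A X0 \<tau>"
proof -
  define h where "h k = step_size T (N k)" for k
  have hpos: "h k > 0" for k unfolding h_def using fine_count(2)[OF N] .
  have hlim: "h \<longlonglongrightarrow> 0" using h0 by (simp add: h_def[abs_def])
  have \<nu>h: "(\<lambda>k. real (\<nu> k) * h k) \<longlonglongrightarrow> \<tau>" using \<tau> by (simp add: grid_pt_def h_def)
  have ylim: "(\<lambda>k. y k (q k)) \<longlonglongrightarrow> x a"
    if q: "\<And>k. q k \<le> \<nu> k" and qa: "(\<lambda>k. grid_pt T (N k) (q k)) \<longlonglongrightarrow> a" for q a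
  proof -
    have "(\<lambda>k. x (grid_pt T (N k) (q k))) \<longlonglongrightarrow> x a"
      using isCont_tendsto_compose[OF _ qa, of x] lipschitz_on_continuous_on[OF xlip]
      by (simp add: continuous_on_eq_continuous_at)
    moreover have "(\<lambda>k. y k (q k) - x (grid_pt T (N k) (q k))) \<longlonglongrightarrow> 0"
    proof (rule tendstoI)
      fix e' :: real assume "e' > 0"
      from conv[OF this]
      show "\<forall>\<^sub>F k in sequentially. dist (y k (q k) - x (grid_pt T (N k) (q k))) 0 < e'"
        by eventually_elim (use q in auto)
    qed
    ultimately show ?thesis using tendsto_add by fastforce
  qed
  have "(\<lambda>k. y k 0) \<longlonglongrightarrow> x 0" by (rule ylim) (auto simp: grid_pt_def)
  then have "x 0 \<in> X0"
    by (rule closed_sequentially[OF compact_imp_closed[OF X0_compact] euler_initial[OF y]])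
  moreover have "x t \<in> A t" if t: "t \<in> {0..\<tau>}" for t
  proof -
    \<comment> \<open>At t = \<open>\<tau>\<close> the rounded index may exceed the last index
      \<open>\<nu> k\<close>. The truncated grid times still tend to
      \<open>min t \<tau> = t\<close>.\<close>
    define q where "q k = min (nat \<lfloor>t / h k\<rfloor>) (\<nu> k)" for k
    have q: "q k \<le> \<nu> k" for k by (simp add: q_def)
    have "(\<lambda>k. min (real (nat \<lfloor>t / h k\<rfloor>) * h k) (real (\<nu> k) * h k)) \<longlonglongrightarrow> min t \<tau>"
      using t by (intro tendsto_min floor_grid_tendsto hpos hlim \<nu>h) auto
    moreover have "min (real (nat \<lfloor>t / h k\<rfloor>) * h k) (real (\<nu> k) * h k) = grid_pt T (N k) (q k)" for k
      unfolding grid_pt_def h_def[symmetric] q_def of_nat_min using hpos[of k]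
      by (simp add: min_mult_distrib_right)
    ultimately have ql: "(\<lambda>k. grid_pt T (N k) (q k)) \<longlonglongrightarrow> t" using t by (simp add: min_absorb1)
    show ?thesis
    proof (rule A_closed_graph[OF _ _ ql _ ylim[OF q ql]])
      show "grid_pt T (N k) (q k) \<in> {0..T}" for k
        using grid_pt_in[OF fine_count(1)[OF N]] q[of k] \<nu>[of k] by simp
      show "t \<in> {0..T}" using t \<open>\<tau> \<in> {0..T}\<close> by auto
      show "y k (q k) \<in> A (grid_pt T (N k) (q k))" for k
        using euler_constraint[OF y fine_count(1)[OF N] \<nu> q] .
    qed
  qed
  moreover have "AE t in lebesgue. t \<in> {0<..<\<tau>} \<longrightarrow> (\<exists>v\<in>F t (x t). (x has_vector_derivative v) (at t))"
    using lipschitz_differentiable_ae[OF xlip]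
  proof eventually_elim
    case (elim t)
    then obtain v where v: "(x has_vector_derivative v) (at t)" by blast
    show ?case
      using euler_limit_derivative[OF N h0 \<nu> \<tau> y xlip conv _ _ v] v \<open>\<tau> \<in> {0..T}\<close> by auto
  qed
  ultimately show ?thesis
    using lipschitz_imp_abs_continuous_on[OF xlip] by (simp add: constrained_sols_def unconstrained_sols_def)
qed

lemma step_size_tendsto_0:
  assumes "filterlim N at_top sequentially"
  shows "(\<lambda>k. step_size T (N k)) \<longlonglongrightarrow> 0"
  unfolding step_size_def
  by (intro real_tendsto_divide_at_top[OF tendsto_const] filterlim_compose[OF filterlim_real_sequentially assms])

text \<open>The end times need only converge; this freedom is what the attainment of
  \<open>max_time\<close> requires.\<close>

lemma euler_compactness:
  assumes N: "\<And>k. N k \<ge> fine_count" and Ninf: "filterlim N at_top sequentially"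
    and \<nu>: "\<And>k. \<nu> k \<le> N k" and \<tau>: "(\<lambda>k. grid_pt T (N k) (\<nu> k)) \<longlonglongrightarrow> \<tau>"
    and y: "\<And>k. y k \<in> euler (N k) (\<nu> k)"
  obtains r x where "strict_mono (r :: nat \<Rightarrow> nat)" "x \<in> constrained_sols F A X0 \<tau>"
    "\<forall>e>0. \<exists>K. \<forall>k\<ge>K. \<forall>n\<le>\<nu> (r k). norm (y (r k) n - x (grid_pt T (N (r k)) n)) < e"
proof -
  obtain r x where r: "strict_mono (r :: nat \<Rightarrow> nat)" and x: "(P + 1)-lipschitz_on UNIV x"
    and conv: "\<forall>e>0. \<exists>K. \<forall>k\<ge>K. \<forall>n\<le>\<nu> (r k). norm (y (r k) n - x (grid_pt T (N (r k)) n)) < e"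
    by (rule euler_limit_exists[of N \<nu> y, OF N \<nu> y])
  have "grid_pt T (N k) (\<nu> k) \<in> {0..T}" for k
    using grid_pt_in[OF fine_count(1)[OF N] \<nu>] .
  then have "\<tau> \<in> {0..T}" using closed_sequentially[OF closed_atLeastAtMost _ \<tau>] by blast
  moreover have "(\<lambda>k. step_size T (N (r k))) \<longlonglongrightarrow> 0"
    using LIMSEQ_subseq_LIMSEQ[OF step_size_tendsto_0[OF Ninf] r] by (simp add: o_def)
  moreover have "(\<lambda>k. grid_pt T (N (r k)) (\<nu> (r k))) \<longlonglongrightarrow> \<tau>"
    using LIMSEQ_subseq_LIMSEQ[OF \<tau> r] by (simp add: o_def)
  ultimately have "x \<in> constrained_sols F A X0 \<tau>"
    using conv by (intro euler_limit_is_constrained_sol[of "\<lambda>k. N (r k)" "\<lambda>k. \<nu> (r k)" \<tau> "\<lambda>k. y (r k)"] N \<nu> y x)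
      (auto simp: eventually_sequentially)
  then show ?thesis using that[OF r] conv by blast
qed

section \<open>Rounding of end times, attainment of the maximal time, and the two assertions\<close>

lemma grid_index_le:
  assumes "N \<ge> 1" "\<tau> \<le> T"
  shows "grid_index T N \<tau> \<le> N"
proof -
  have "\<tau> / step_size T N \<le> T / step_size T N"
    using step_size_pos[OF assms(1)] assms(2) by (simp add: divide_right_mono)
  also have "\<dots> = real N" using T_pos assms(1) by (simp add: step_size_def)
  finally have "\<lfloor>\<tau> / step_size T N\<rfloor> \<le> int N" by linarith
  then show ?thesis by (simp add: grid_index_def)
qed

lemma grid_index_bounds:
  assumes "N \<ge> 1" "\<tau> \<ge> 0"
  shows "grid_pt T N (grid_index T N \<tau>) \<le> \<tau>" "\<tau> - step_size T N < grid_pt T N (grid_index T N \<tau>)"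
  using floor_grid_bounds[OF step_size_pos[OF assms(1)] assms(2)]
  by (simp_all add: grid_pt_def grid_index_def)

lemma grid_index_tendsto:
  assumes N: "\<And>k. N k \<ge> fine_count" "filterlim N at_top sequentially"
    and s: "\<And>k. s k \<ge> 0" "s \<longlonglongrightarrow> \<tau>"
  shows "(\<lambda>k. grid_pt T (N k) (grid_index T (N k) (s k))) \<longlonglongrightarrow> \<tau>"
proof (rule tendsto_sandwich)
  show "(\<lambda>k. s k - step_size T (N k)) \<longlonglongrightarrow> \<tau>"
    using tendsto_diff[OF s(2) step_size_tendsto_0[OF N(2)]] by simp
  note b = grid_index_bounds[OF fine_count(1)[OF N(1)] s(1)]
  show "\<forall>\<^sub>F k in sequentially. s k - step_size T (N k) \<le> grid_pt T (N k) (grid_index T (N k) (s k))"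
    using less_imp_le[OF b(2)] by (rule always_eventually[OF allI])
  show "\<forall>\<^sub>F k in sequentially. grid_pt T (N k) (grid_index T (N k) (s k)) \<le> s k"
    using b(1) by (rule always_eventually[OF allI])
qed (rule s(2))

lemma constrained_sols_max_time_nonempty:
  assumes "\<exists>\<tau>\<in>{0<..T}. constrained_sols F A X0 \<tau> \<noteq> {}"
  shows "constrained_sols F A X0 (max_time T F A X0) \<noteq> {}"
proof -
  define S where "S = {\<tau> \<in> {0<..T}. constrained_sols F A X0 \<tau> \<noteq> {}}"
  have S: "S \<noteq> {}" "bdd_above S" using assms by (auto simp: S_def bdd_above_def)
  have Sup: "max_time T F A X0 = Sup S" by (simp add: S_def max_time_def)
  have "\<exists>s\<in>S. Sup S - 1 / real (Suc k) < s" for k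
    using less_cSup_iff[OF S, of "Sup S - 1 / real (Suc k)"] by simp
  then obtain s where s: "\<And>k. s k \<in> S" "\<And>k. Sup S - 1 / real (Suc k) < s k" by metis
  have "s \<longlonglongrightarrow> Sup S"
  proof (rule tendsto_sandwich)
    show "(\<lambda>k. Sup S - 1 / real (Suc k)) \<longlonglongrightarrow> Sup S"
      using tendsto_diff[OF tendsto_const LIMSEQ_inverse_real_of_nat, of "Sup S"] by (simp add: inverse_eq_divide)
    show "\<forall>\<^sub>F k in sequentially. Sup S - 1 / real (Suc k) \<le> s k"
      using s(2) by (auto intro!: always_eventually less_imp_le)
    show "\<forall>\<^sub>F k in sequentially. s k \<le> Sup S"
      using cSup_upper[OF s(1) S(2)] by (auto intro!: always_eventually)
  qed simp
  have s0: "0 \<le> s k" "s k \<le> T" "\<exists>x. x \<in> constrained_sols F A X0 (s k)" for k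
    using s(1)[of k] by (auto simp: S_def)
  then obtain x where x: "\<And>k. x k \<in> constrained_sols F A X0 (s k)" by metis
  \<comment> \<open>Sampling works on every grid, so the grids can be refined independently of how
    fast \<open>s k\<close> approaches the supremum.\<close>
  define N where "N k = fine_count + k" for k
  have N: "N k \<ge> fine_count" for k by (simp add: N_def)
  have Ninf: "filterlim N at_top sequentially" by (rule filterlim_at_top_of_ge) (simp add: N_def)
  define \<nu> where "\<nu> k = grid_index T (N k) (s k)" for k
  have \<nu>: "\<nu> k \<le> N k" for k unfolding \<nu>_def by (rule grid_index_le[OF fine_count(1)[OF N] s0(2)])
  have "(\<lambda>n. x k (grid_pt T (N k) n)) \<in> euler (N k) (\<nu> k)" for k
    unfolding \<nu>_def
    using sampled_sol_in_euler[OF x s0(2) fine_count(1)[OF N] grid_index_bounds(1)[OF fine_count(1)[OF N] s0(1)]] .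
  moreover have "(\<lambda>k. grid_pt T (N k) (\<nu> k)) \<longlonglongrightarrow> Sup S"
    unfolding \<nu>_def by (rule grid_index_tendsto[OF N Ninf s0(1) \<open>s \<longlonglongrightarrow> Sup S\<close>])
  ultimately obtain z where "z \<in> constrained_sols F A X0 (Sup S)"
    using euler_compactness[OF N Ninf \<nu>, of "Sup S" "\<lambda>k n. x k (grid_pt T (N k) n)"] by metis
  then show ?thesis using Sup by auto
qed

text \<open>The shared core of both contradictions. The predicate Q records the violation of the
  claim and is passed to members close to the limit: it says "far from all solutions" for
  convergence and \<open>True\<close> for emptiness.\<close>

lemma euler_sequence_compactness:
  assumes \<tau>: "0 \<le> \<tau>" "\<tau> \<le> T"
    and y: "\<And>M. \<exists>N\<ge>M. \<exists>y\<in>euler N (grid_index T N \<tau>). Q N y"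
  shows "\<exists>x\<in>constrained_sols F A X0 \<tau>. \<forall>e>0. \<exists>N y. y \<in> euler N (grid_index T N \<tau>) \<and> Q N y \<and>
    (\<forall>n\<le>grid_index T N \<tau>. norm (y n - x (grid_pt T N n)) < e)"
proof -
  have "\<forall>k. \<exists>N y. N \<ge> fine_count + k \<and> y \<in> euler N (grid_index T N \<tau>) \<and> Q N y"
    using y by blast
  then obtain N y where N: "\<And>k. N k \<ge> fine_count + k"
    and yk: "\<And>k. y k \<in> euler (N k) (grid_index T (N k) \<tau>)" and Q: "\<And>k. Q (N k) (y k)"
    by metis
  have N1: "N k \<ge> fine_count" "N k \<ge> k" for k using N[of k] by auto
  have Ninf: "filterlim N at_top sequentially" by (rule filterlim_at_top_of_ge) (rule N1)
  obtain r x where "strict_mono (r :: nat \<Rightarrow> nat)" and x: "x \<in> constrained_sols F A X0 \<tau>"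
    and conv: "\<forall>e>0. \<exists>K. \<forall>k\<ge>K. \<forall>n\<le>grid_index T (N (r k)) \<tau>. norm (y (r k) n - x (grid_pt T (N (r k)) n)) < e"
    by (rule euler_compactness[OF N1(1) Ninf grid_index_le[OF fine_count(1)[OF N1(1)] \<tau>(2)]
        grid_index_tendsto[OF N1(1) Ninf \<tau>(1) tendsto_const] yk])
  show ?thesis
  proof (intro bexI[OF _ x] allI impI)
    fix e :: real assume "e > 0"
    then obtain K where "\<forall>n\<le>grid_index T (N (r K)) \<tau>. norm (y (r K) n - x (grid_pt T (N (r K)) n)) < e"
      using conv by blast
    then show "\<exists>N y. y \<in> euler N (grid_index T N \<tau>) \<and> Q N y \<and>
        (\<forall>n\<le>grid_index T N \<tau>. norm (y n - x (grid_pt T N n)) < e)"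
      using yk Q by blast
  qed
qed

lemma euler_convergence:
  assumes \<tau>: "0 < \<tau>" "\<tau> \<le> T" and ne: "constrained_sols F A X0 \<tau> \<noteq> {}"
  shows "(\<lambda>N. SUP y\<in>euler N (grid_index T N \<tau>). INF x\<in>constrained_sols F A X0 \<tau>.
            ereal (MAX n\<in>{0..grid_index T N \<tau>}. norm (y n - x (grid_pt T N n)))) \<longlonglongrightarrow> 0"
proof -
  define D where "D N y x = ereal (MAX n\<in>{0..grid_index T N \<tau>}. norm (y n - x (grid_pt T N n)))"
    for N and y :: "nat \<Rightarrow> 'a" and x
  define E where "E N = (SUP y\<in>euler N (grid_index T N \<tau>). INF x\<in>constrained_sols F A X0 \<tau>. D N y x)" for N
  have D0: "0 \<le> D N y x" for N y x
    unfolding D_def zero_ereal_def ereal_less_eq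
    by (subst Max_ge_iff) (auto intro!: bexI[of _ 0])
  have Dle: "D N y x \<le> ereal e" if "\<forall>n\<le>grid_index T N \<tau>. norm (y n - x (grid_pt T N n)) < e" for N y x e
    unfolding D_def ereal_less_eq using that by (subst Max_le_iff) (auto intro: less_imp_le)
  have "E \<longlonglongrightarrow> 0"
  proof (rule order_tendstoI)
    fix a :: ereal assume "a < 0"
    have "a < E N" if "N \<ge> 1" for N
    proof -
      \<comment> \<open>A supremum over an empty set would be minus infinity in
        \<open>ereal\<close>; a sampled solution shows that the Euler set is nonempty.\<close>
      obtain x where "x \<in> constrained_sols F A X0 \<tau>" using ne by blast
      then have "(\<lambda>n. x (grid_pt T N n)) \<in> euler N (grid_index T N \<tau>)"
        using sampled_sol_in_euler[OF _ \<tau>(2) that grid_index_bounds(1)[OF that]] \<tau>(1) by simp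
      then have "0 \<le> E N" unfolding E_def by (rule SUP_upper2) (intro INF_greatest D0)
      then show ?thesis using \<open>a < 0\<close> by simp
    qed
    then show "\<forall>\<^sub>F N in sequentially. a < E N" unfolding eventually_sequentially by blast
  next
    fix a :: ereal assume "0 < a"
    then obtain e where e: "0 < ereal e" "ereal e < a" using ereal_dense2 by blast
    have "\<exists>M. \<forall>N\<ge>M. E N < a"
    proof (rule ccontr)
      assume "\<nexists>M. \<forall>N\<ge>M. E N < a"
      then have far: "\<exists>N\<ge>M. \<not> E N < a" for M by blast
      have "\<exists>N\<ge>M. \<exists>y\<in>euler N (grid_index T N \<tau>). (INF x\<in>constrained_sols F A X0 \<tau>. D N y x) > ereal e" for M
      proof -
        obtain N where N: "N \<ge> M" "\<not> E N < a" using far by blast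
        then have "ereal e < E N" using e(2) by simp
        then show ?thesis using N(1) unfolding E_def less_SUP_iff by blast
      qed
      \<comment> \<open>The limit x is itself a competitor in the infimum, so a y within e of x
        cannot have infimum above e.\<close>
      from euler_sequence_compactness[OF less_imp_le[OF \<tau>(1)] \<tau>(2) this]
      obtain x N y where x: "x \<in> constrained_sols F A X0 \<tau>"
        and "(INF x\<in>constrained_sols F A X0 \<tau>. D N y x) > ereal e"
        and le: "\<forall>n\<le>grid_index T N \<tau>. norm (y n - x (grid_pt T N n)) < e"
        using e(1) by (metis ereal_less(2))
      moreover have "(INF x\<in>constrained_sols F A X0 \<tau>. D N y x) \<le> ereal e"
        using Dle[OF le] by (rule INF_lower2[OF x])
      ultimately show False by simp
    qed
    then show "\<forall>\<^sub>F N in sequentially. E N < a" unfolding eventually_sequentially .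
  qed
  then show ?thesis unfolding E_def D_def .
qed

lemma euler_eventually_empty:
  assumes \<tau>: "0 \<le> \<tau>" "\<tau> \<le> T" and empty: "constrained_sols F A X0 \<tau> = {}"
  shows "\<exists>M. \<forall>N\<ge>M. euler N (grid_index T N \<tau>) = {}"
proof (rule ccontr)
  assume "\<nexists>M. \<forall>N\<ge>M. euler N (grid_index T N \<tau>) = {}"
  then have "\<exists>N\<ge>M. \<exists>y\<in>euler N (grid_index T N \<tau>). True" for M by blast
  from euler_sequence_compactness[OF \<tau> this] show False using empty by blast
qed

end

section \<open>Control of the constants, and the final theorem\<close>

lemma norm_le_init_speed:
  assumes compact: "\<And>x. x \<in> X0 \<Longrightarrow> compact (F 0 x)" "\<And>x. x \<in> X0 \<Longrightarrow> F 0 x \<noteq> {}" and "compact X0"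
    and lip: "\<And>x x' v. v \<in> F 0 x \<Longrightarrow> \<exists>w\<in>F 0 x'. norm (v - w) \<le> L * norm (x - x')"
    and "L \<ge> 0" and x: "x \<in> X0" and v: "v \<in> F 0 x"
  shows "norm v \<le> init_speed F X0"
proof -
  have bdd: "bdd_above (norm ` F 0 z)" if "z \<in> X0" for z
    using compact_imp_bounded[OF compact(1)[OF that]] by (auto simp: bounded_iff bdd_above_def)
  obtain B where B: "\<And>w. w \<in> F 0 x \<Longrightarrow> norm w \<le> B"
    using bdd[OF x] by (auto simp: bdd_above_def)
  obtain C where C: "\<And>z. z \<in> X0 \<Longrightarrow> norm z \<le> C"
    using compact_imp_bounded[OF \<open>compact X0\<close>] by (auto simp: bounded_iff)
  \<comment> \<open>A real supremum dominates its terms only when it is bounded. The inner suprema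
    are bounded uniformly by comparing z with the fixed point x through the Lipschitz
    condition.\<close>
  have "(SUP v\<in>F 0 z. norm v) \<le> B + L * (C + C)" if z: "z \<in> X0" for z
  proof (rule cSUP_least[OF compact(2)[OF z]])
    fix u assume "u \<in> F 0 z"
    then obtain w where w: "w \<in> F 0 x" "norm (u - w) \<le> L * norm (z - x)" using lip by blast
    have "norm (z - x) \<le> C + C" using C[OF z] C[OF x] norm_triangle_ineq4[of z x] by linarith
    then have "L * norm (z - x) \<le> L * (C + C)" using \<open>L \<ge> 0\<close> by (rule mult_left_mono)
    then show "norm u \<le> B + L * (C + C)" using w B[OF w(1)] norm_triangle_sub[of u w] by linarith
  qed
  then have bdd': "bdd_above ((\<lambda>z. SUP v\<in>F 0 z. norm v) ` X0)" by (rule bdd_aboveI2)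
  have "norm v \<le> (SUP v\<in>F 0 x. norm v)" using v bdd[OF x] by (rule cSUP_upper)
  also have "\<dots> \<le> init_speed F X0" unfolding init_speed_def using x bdd' by (rule cSUP_upper)
  finally show ?thesis .
qed

text \<open>The N = 1 term bounds the supremum from below, and a factor at least 1 does not decrease
  a nonnegative bracket.\<close>

lemma radius_const_ge:
  assumes "T > 0" "L > 0" "init_speed F X0 \<ge> 0" "P + 1 \<ge> 0"
    and \<beta>: "\<And>N. N \<ge> 1 \<Longrightarrow> \<beta> N = L * (P + 1) * (step_size T N)\<^sup>2"
  shows "init_speed F X0 + (P + 1) * T + 1 \<le> radius_const T L F X0 \<beta> (\<lambda>N. 0)"
proof -
  have summand: "0 + \<beta> N / (L * step_size T N) = (P + 1) * T / real N" if "N \<ge> 1" for N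
    using \<beta>[OF that] assms(1,2) that by (simp add: step_size_def power2_eq_square)
  have "bdd_above ((\<lambda>N. 0 + \<beta> N / (L * step_size T N)) ` {1..})"
  proof (rule bdd_aboveI2)
    fix N :: nat assume "N \<in> {1..}"
    then show "0 + \<beta> N / (L * step_size T N) \<le> (P + 1) * T"
      using summand[of N] assms(1,4) mult_left_mono[of 1 "real N" "(P + 1) * T"] by (simp add: divide_le_eq)
  qed
  then have "0 + \<beta> 1 / (L * step_size T 1) \<le> (SUP N\<in>{1..}. 0 + \<beta> N / (L * step_size T N))"
    by (intro cSUP_upper) auto
  then have Sup: "(P + 1) * T \<le> (SUP N\<in>{1..}. 0 + \<beta> N / (L * step_size T N))"
    using summand[of 1] by simp
  define B where "B = init_speed F X0 + (SUP N\<in>{1..}. 0 + \<beta> N / (L * step_size T N)) + 1"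
  have "init_speed F X0 + (P + 1) * T + 1 \<le> B"
    unfolding B_def by (intro add_right_mono add_left_mono Sup)
  have "(P + 1) * T \<ge> 0" using assms by simp
  then have "B \<ge> 0" using \<open>init_speed F X0 + (P + 1) * T + 1 \<le> B\<close> assms(3) by linarith
  have "1 * 1 \<le> max 1 (1 / L) * exp (L * T)"
    using assms(1,2) by (intro mult_mono) auto
  then have "1 * B \<le> max 1 (1 / L) * exp (L * T) * B" using \<open>B \<ge> 0\<close> by (intro mult_right_mono) auto
  also have "\<dots> = radius_const T L F X0 \<beta> (\<lambda>N. 0)" by (simp only: radius_const_def B_def)
  finally show ?thesis using \<open>init_speed F X0 + (P + 1) * T + 1 \<le> B\<close> by linarith
qed

theorem proposition7:
  fixes T L R P :: real
    and F :: "real \<Rightarrow> real ^ 'd \<Rightarrow> (real ^ 'd) set"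
    and A :: "real \<Rightarrow> (real ^ 'd) set"
    and X0 :: "(real ^ 'd) set"
    and \<beta> :: "nat \<Rightarrow> real"
  assumes "T > 0" and "L > 0"
    and "\<And>t x. t \<in> {0..T} \<Longrightarrow> F t x \<noteq> {} \<and> convex (F t x) \<and> compact (F t x)"
    and "\<And>t t' x x'. t \<in> {0..T} \<Longrightarrow> t' \<in> {0..T} \<Longrightarrow>
           excess (F t x) (F t' x') \<le> ereal (L * \<bar>t - t'\<bar> + L * norm (x - x'))"
    and "\<And>t. t \<in> {0..T} \<Longrightarrow> closed (A t)"
    and "\<And>s t z x. (\<And>n::nat. s n \<in> {0..T}) \<Longrightarrow> t \<in> {0..T} \<Longrightarrow> s \<longlonglongrightarrow> t \<Longrightarrow>
           (\<And>n. z n \<in> A (s n)) \<Longrightarrow> z \<longlonglongrightarrow> x \<Longrightarrow> x \<in> A t"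
    and "compact X0"
    and "\<exists>\<tau>\<in>{0<..T}. constrained_sols F A X0 \<tau> \<noteq> {}"
    and "\<And>N. N \<ge> 1 \<Longrightarrow> \<beta> N = L * (P + 1) * (step_size T N)\<^sup>2"
    and "\<And>N. N \<ge> 1 \<Longrightarrow> \<beta> N \<ge> 0"
    and "R = radius_const T L F X0 \<beta> (\<lambda>N. 0)"
    and "P = speed_const T L F X0 R"
  shows "(\<forall>\<tau>\<in>{0<..max_time T F A X0}.
            (\<lambda>N. SUP y\<in>inflated_euler T F A X0 N (grid_index T N \<tau>) (\<beta> N) 0.
                  INF x\<in>constrained_sols F A X0 \<tau>.
                    ereal (MAX n\<in>{0..grid_index T N \<tau>}. norm (y n - x (grid_pt T N n))))
              \<longlonglongrightarrow> 0) \<and>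
         (\<forall>\<tau>\<in>{max_time T F A X0<..T}. \<exists>N\<^sub>\<tau>. \<forall>N\<ge>N\<^sub>\<tau>.
            inflated_euler T F A X0 N (grid_index T N \<tau>) (\<beta> N) 0 = {})"
proof -
  have F: "F t x \<noteq> {}" "convex (F t x)" "compact (F t x)" if "t \<in> {0..T}" for t x
    using assms(3)[OF that] by auto
  have lip: "\<exists>w\<in>F t' x'. norm (v - w) \<le> L * \<bar>t - t'\<bar> + L * norm (x - x')"
    if "t \<in> {0..T}" "t' \<in> {0..T}" "v \<in> F t x" for t t' x x' v
    using excess_compact_attained[OF assms(4) F(3) F(1)] that by blast
  have zero: "0 \<in> {0..T}" using \<open>T > 0\<close> by simp
  have init: "norm v \<le> init_speed F X0" if "x \<in> X0" "v \<in> F 0 x" for x v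
    using norm_le_init_speed[of X0 F L x v] F[OF zero] \<open>compact X0\<close> lip[OF zero zero] \<open>L > 0\<close> that by simp
  obtain \<tau>0 where "\<tau>0 \<in> {0<..T}" "constrained_sols F A X0 \<tau>0 \<noteq> {}" using assms(8) by blast
  then obtain x0 where "x0 \<in> X0" by (auto simp: constrained_sols_def unconstrained_sols_def)
  obtain v0 where "v0 \<in> F 0 x0" using F(1)[OF zero, of x0] by blast
  then have "norm v0 \<le> init_speed F X0" using init[OF \<open>x0 \<in> X0\<close>] by blast
  then have s0: "init_speed F X0 \<ge> 0" using norm_ge_zero order_trans by blast
  \<comment> \<open>The sign of \<open>P\<close> cannot be read off its coupled definition before
    \<open>R\<close> is known. Nonnegativity of the blowup at N = 1 gives \<open>P + 1 >= 0\<close>,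
    which bounds \<open>R\<close> from below, and this in turn yields \<open>P >= 0\<close>.\<close>
  have "L * (P + 1) * (step_size T 1)\<^sup>2 \<ge> 0" using assms(9)[of 1] assms(10)[of 1] by simp
  then have P1: "P + 1 \<ge> 0" using \<open>T > 0\<close> \<open>L > 0\<close> by (simp add: step_size_def zero_le_mult_iff)
  have R: "init_speed F X0 + (P + 1) * T + 1 \<le> R"
    unfolding assms(11) by (rule radius_const_ge[OF \<open>T > 0\<close> \<open>L > 0\<close> s0 P1 assms(9)])
  have PT: "(P + 1) * T \<ge> 0" using P1 \<open>T > 0\<close> by simp
  have P: "P = L * (T + R) + init_speed F X0" using assms(12) by (simp add: speed_const_def)
  interpret constrained_inclusion T L R P F A X0
  proof (unfold_locales, fact assms(1), fact assms(2))
    show "P \<ge> 0" unfolding P using R PT s0 \<open>T > 0\<close> \<open>L > 0\<close> by simp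
    show "(P + 1) * T < R" using R s0 by simp
    \<comment> \<open>The summands of \<open>P\<close> are the cost of moving from time t to 0, of
      moving from z to x, and the speed at the initial point.\<close>
    fix t x z v assume t: "t \<in> {0..T}" and x: "x \<in> X0" and z: "norm (z - x) \<le> R" and v: "v \<in> F t z"
    obtain w where w: "w \<in> F 0 x" "norm (v - w) \<le> L * \<bar>t - 0\<bar> + L * norm (z - x)"
      using lip[OF t zero v] by blast
    have "L * \<bar>t - 0\<bar> \<le> L * T" "L * norm (z - x) \<le> L * R" using t z \<open>L > 0\<close> by auto
    then show "norm v \<le> P"
      unfolding P using w(2) init[OF x w(1)] norm_triangle_sub[of v w] by (simp add: distrib_left)
  qed (fact F(2) F(3) lip assms(5) assms(6) assms(7))+
  let ?S = "{\<tau> \<in> {0<..T}. constrained_sols F A X0 \<tau> \<noteq> {}}"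
  have bdd: "bdd_above ?S" by (auto simp: bdd_above_def)
  have max_T: "max_time T F A X0 \<le> T"
    unfolding max_time_def using assms(8) by (intro cSup_least) auto
  have max_0: "0 < max_time T F A X0"
    using cSup_upper[OF _ bdd, of \<tau>0] \<open>\<tau>0 \<in> {0<..T}\<close> \<open>constrained_sols F A X0 \<tau>0 \<noteq> {}\<close>
    by (simp add: max_time_def)
  show ?thesis
  proof (intro conjI ballI)
    fix \<tau> assume \<tau>: "\<tau> \<in> {0<..max_time T F A X0}"
    then have "constrained_sols F A X0 \<tau> \<noteq> {}"
      using constrained_sols_max_time_nonempty[OF assms(8)] constrained_sols_antimono[of \<tau> "max_time T F A X0"]
      by auto
    then have lim: "(\<lambda>N. SUP y\<in>euler N (grid_index T N \<tau>). INF x\<in>constrained_sols F A X0 \<tau>.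
        ereal (MAX n\<in>{0..grid_index T N \<tau>}. norm (y n - x (grid_pt T N n)))) \<longlonglongrightarrow> 0"
      using \<tau> max_T by (intro euler_convergence) auto
    \<comment> \<open>The formula for \<open>\<beta> N\<close> is available from N = 1 on, so the
      sequences agree only eventually.\<close>
    show "(\<lambda>N. SUP y\<in>inflated_euler T F A X0 N (grid_index T N \<tau>) (\<beta> N) 0. INF x\<in>constrained_sols F A X0 \<tau>.
        ereal (MAX n\<in>{0..grid_index T N \<tau>}. norm (y n - x (grid_pt T N n)))) \<longlonglongrightarrow> 0"
      by (rule Lim_transform_eventually[OF lim])
        (use eventually_ge_at_top[of 1] in \<open>eventually_elim, simp add: assms(9)\<close>)
  next
    fix \<tau> assume \<tau>: "\<tau> \<in> {max_time T F A X0<..T}"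
    have "\<tau> \<notin> ?S" using cSup_upper[OF _ bdd, of \<tau>] \<tau> by (auto simp: max_time_def)
    then have "constrained_sols F A X0 \<tau> = {}" using \<tau> max_0 by auto
    then obtain M where M: "\<And>N. N \<ge> M \<Longrightarrow> euler N (grid_index T N \<tau>) = {}"
      using euler_eventually_empty[of \<tau>] \<tau> max_0 by auto
    then show "\<exists>N\<^sub>\<tau>. \<forall>N\<ge>N\<^sub>\<tau>. inflated_euler T F A X0 N (grid_index T N \<tau>) (\<beta> N) 0 = {}"
      by (intro exI[of _ "max 1 M"]) (simp add: assms(9))
  qed
qed

end
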